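(* There exists a transcendental meromorphic function $f\colon\mathbb{C}\to\hat{\mathbb{C}}$ that has an invariant Baker domain and such that every point of $\operatorname{sing}(f^{-1})$ is a super-attracting periodic point of $f$ of period $2$.
   Context: $\hat{\mathbb{C}}=\mathbb{C}\cup\{\infty\}$ is the Riemann sphere. A transcendental meromorphic function is a holomorphic map $f\colon\mathbb{C}\to\hat{\mathbb{C}}$ with an essential singularity at $\infty$ (i.e. not the restriction of a rational map). The Fatou set $F(f)$ is the set of $z\in\mathbb{C}$ having a neighbourhood on which all iterates $f^n$ are defined and form a normal family in the sense of Montel. A Fatou component is a connected component $U$ of $F(f)$; it is invariant if $f(U)\subset U$. An invariant Baker domain is an invariant Fatou component $U$ such that $f^n(z)\to\infty$ as $n\to\infty$ for all $z\in U$. $\operatorname{sing}(f^{-1})\subset\mathbb{C}$ is the set of finite critical values and finite asymptotic values of $f$. A critical value is the image $f(c)$ of a critical point $c\in\mathbb{C}$ (a point near which $f$ is not locally injective). A value $a$ is an asymptotic value if there is a curve $\gamma\colon[0,\infty)\to\mathbb{C}$ with $\gamma(t)\to\infty$ and $f(\gamma(t))\to a$ as $t\to\infty$. A point $z\in\mathbb{C}$ is a super-attracting periodic point of period $2$ if $f(z)\in\mathbb{C}$, $f(z)\neq z$, $f^2(z)=z$ and $(f^2)'(z)=0$. *)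

theory Defs
  imports "HOL-Complex_Analysis.Complex_Analysis"
begin

text \<open>
  A meromorphic function is represented as a total function of type \<open>complex \<Rightarrow> complex\<close>
  that is \<open>nicely_meromorphic_on UNIV\<close>. The map into the Riemann sphere which it stands for takes
  the value infinity exactly at the points \<open>z\<close> with \<open>is_pole f z\<close>; there the value of the
  total function is the dummy 0, so every notion below has to treat poles explicitly.
\<close>

text \<open>
  The restrictions of rational maps are excluded by asking that \<open>f\<close> agree with no quotient of
  polynomials off the zeros of the denominator. (The constant map to infinity, which is rational,
  is already excluded by the representation.)
\<close>

definition transcendental_meromorphic :: "(complex \<Rightarrow> complex) \<Rightarrow> bool" where
  "transcendental_meromorphic f \<longleftrightarrow>
     f nicely_meromorphic_on UNIV \<and>
     \<not> (\<exists>p q :: complex poly. q \<noteq> 0 \<and> (\<forall>z. poly q z \<noteq> 0 \<longrightarrow> f z = poly p z / poly q z))"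

text \<open>
  Inverse stereographic projection onto the unit sphere of \<open>\<complex> \<times> \<real>\<close>, with infinity
  corresponding to the north pole \<open>(0, 1)\<close>. The Euclidean distance between image points is the
  chordal distance on the Riemann sphere.
\<close>

definition to_sphere :: "complex \<Rightarrow> complex \<times> real" where
  "to_sphere z = ((2 / ((norm z)\<^sup>2 + 1)) *\<^sub>R z, ((norm z)\<^sup>2 - 1) / ((norm z)\<^sup>2 + 1))"

text \<open>
  Normality in the sense of Montel, for families of functions that are finite on \<open>U\<close>: convergence
  is locally uniform with respect to the chordal metric, so infinity is allowed as a limit value. The
  limit \<open>g\<close> automatically takes its values on the unit sphere (over \<open>U\<close>).
\<close>

definition normal_family_on :: "(complex \<Rightarrow> complex) set \<Rightarrow> complex set \<Rightarrow> bool" where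
  "normal_family_on \<F> U \<longleftrightarrow>
     (\<forall>s :: nat \<Rightarrow> complex \<Rightarrow> complex. range s \<subseteq> \<F> \<longrightarrow>
       (\<exists>(r :: nat \<Rightarrow> nat) g. strict_mono r \<and>
         (\<forall>K. compact K \<and> K \<subseteq> U \<longrightarrow>
           uniform_limit K (\<lambda>n z. to_sphere (s (r n) z)) g sequentially)))"

text \<open>
  The iterate \<open>f\<^sup>n\<close> is defined at \<open>z\<close> when \<open>z, f z, \<dots>\<close> up to the iterate number \<open>n - 1\<close>
  are all finite; hence all iterates are defined iff the orbit never meets a pole.
\<close>

definition iterates_defined :: "(complex \<Rightarrow> complex) \<Rightarrow> complex \<Rightarrow> bool" where
  "iterates_defined f z \<longleftrightarrow> (\<forall>n. \<not> is_pole f ((f ^^ n) z))"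

definition fatou_set :: "(complex \<Rightarrow> complex) \<Rightarrow> complex set" where
  "fatou_set f = {z. \<exists>U. open U \<and> z \<in> U \<and> (\<forall>w\<in>U. iterates_defined f w) \<and>
                       normal_family_on (range (\<lambda>n. f ^^ n)) U}"

definition invariant_fatou_component :: "(complex \<Rightarrow> complex) \<Rightarrow> complex set \<Rightarrow> bool" where
  "invariant_fatou_component f U \<longleftrightarrow> U \<in> components (fatou_set f) \<and> f ` U \<subseteq> U"

definition invariant_baker_domain :: "(complex \<Rightarrow> complex) \<Rightarrow> complex set \<Rightarrow> bool" where
  "invariant_baker_domain f U \<longleftrightarrow>
     invariant_fatou_component f U \<and>
     (\<forall>z\<in>U. filterlim (\<lambda>n. (f ^^ n) z) at_infinity sequentially)"

text \<open>Multiple poles are critical points as well, but their critical value is not finite.\<close>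

definition finite_critical_values :: "(complex \<Rightarrow> complex) \<Rightarrow> complex set" where
  "finite_critical_values f =
     {f c | c. \<not> is_pole f c \<and> \<not> (\<exists>V. open V \<and> c \<in> V \<and> inj_on f V)}"

text \<open>
  Convergence to a finite value on the Riemann sphere means being eventually finite and converging
  in the plane.
\<close>

definition finite_asymptotic_values :: "(complex \<Rightarrow> complex) \<Rightarrow> complex set" where
  "finite_asymptotic_values f =
     {a. \<exists>\<gamma> :: real \<Rightarrow> complex. continuous_on {0..} \<gamma> \<and> filterlim \<gamma> at_infinity at_top \<and>
           (\<forall>\<^sub>F t in at_top. \<not> is_pole f (\<gamma> t)) \<and> ((\<lambda>t. f (\<gamma> t)) \<longlongrightarrow> a) at_top}"

definition sing_inverse :: "(complex \<Rightarrow> complex) \<Rightarrow> complex set" where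
  "sing_inverse f = finite_critical_values f \<union> finite_asymptotic_values f"

definition super_attracting_period_2 :: "(complex \<Rightarrow> complex) \<Rightarrow> complex \<Rightarrow> bool" where
  "super_attracting_period_2 f z \<longleftrightarrow>
     \<not> is_pole f z \<and> f z \<noteq> z \<and>
     \<not> is_pole f (f z) \<and> f (f z) = z \<and>
     ((f ^^ 2) has_field_derivative 0) (at z)"

end

theory Submission
  imports Defs
begin

text \<open>
  The function is \<open>f z = \<lambda> (z + \<Sum>\<^sub>n s\<^sub>n\<^sup>2 / (z - p\<^sub>n))\<close> with \<open>\<lambda> = 10\<^sup>6\<close>, \<open>s\<^sub>n\<close> close to 1 and very widely
  separated poles \<open>p\<^sub>n\<close> in the right half plane. Away from the poles it is a small perturbation of
  \<open>z \<mapsto> \<lambda> z\<close>. Hence the half plane \<open>Re z < -1\<close> is mapped into itself with \<open>Re f\<^sup>n \<rightarrow> -\<infinity>\<close>, so that it lies in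
  an invariant Baker domain; there are no finite asymptotic values; and near each pole \<open>f\<close> looks like a
  Joukowski map, with exactly two critical points \<open>c \<approx> p\<^sub>n \<plusminus> 1\<close> and critical values
  \<open>v \<approx> \<lambda> (p\<^sub>n \<plusminus> 2)\<close>. Putting a further pole next to each critical value \<open>v\<close>, at the distance for which
  \<open>f v = c\<close>, makes \<open>{c, v}\<close> a superattracting cycle. The new pole creates two new critical values, so the
  poles form an infinite binary tree, and its parameters solve an infinite system of equations to which
  the contraction principle applies.
\<close>

subsection \<open>Fixed points and sums\<close>

text \<open>Each pole has two free parameters, its position and its residue, and its two critical
  values must land at prescribed places next to poles of the following generation, so equations and
  unknowns balance. The obstacle is that no pole can be fixed once and for all: every pole shifts
  the critical points and values belonging to all others, and an error in a pole is magnified about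
  \<lambda> times in its critical values. Building the tree outwards from its root would therefore
  be unstable. Each pole is recovered from the next generation instead, and the large \<lambda> then
  damps errors; the value 10^6 leaves room for crude estimates. The cycles are superattracting
  because the multiplier contains the factor f'(c) = 0. Of the Baker domain only the half plane is
  explicit: escape spreads to the rest of its Fatou component by normality and Hurwitz's theorem,
  applied to reciprocals of iterates.\<close>

text \<open>Banach's theorem for the weighted supremum metric on functions over an arbitrary index
  set. No metric space is formed: a bound \<open>K * w i\<close> for all \<open>i\<close> stands for
  distance at most \<open>K\<close>, and limits are taken in each coordinate separately.
  \<open>diam\<close> keeps the first distance finite.\<close>

lemma weighted_contraction_fixpoint:
  fixes \<Phi> :: "('i \<Rightarrow> 'a::banach) \<Rightarrow> 'i \<Rightarrow> 'a" and w :: "'i \<Rightarrow> real"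
  assumes closed: "\<And>i. closed (B i)" and x0: "\<And>i. x0 i \<in> B i"
    and self: "\<And>x i. (\<And>i. x i \<in> B i) \<Longrightarrow> \<Phi> x i \<in> B i"
    and diam: "\<And>i x y. x \<in> B i \<Longrightarrow> y \<in> B i \<Longrightarrow> norm (x - y) \<le> M * w i"
    and M: "M \<ge> 0" and \<theta>: "0 \<le> \<theta>" "\<theta> < 1"
    and contr: "\<And>x y K i. (\<And>i. x i \<in> B i) \<Longrightarrow> (\<And>i. y i \<in> B i) \<Longrightarrow> K \<ge> 0 \<Longrightarrow>
        (\<And>i. norm (x i - y i) \<le> K * w i) \<Longrightarrow> norm (\<Phi> x i - \<Phi> y i) \<le> \<theta> * K * w i"
  obtains x where "\<And>i. x i \<in> B i" "\<Phi> x = x"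
proof -
  define X where "X k = (\<Phi> ^^ k) x0" for k
  have XS: "X (Suc k) = \<Phi> (X k)" for k by (simp add: X_def)
  have XB: "X k i \<in> B i" for k i
    by (induction k arbitrary: i) (auto simp: XS x0 self X_def)
  have gap: "norm (X (k + m) i - X k i) \<le> \<theta> ^ k * M * w i" for k m i
  proof (induction k arbitrary: i)
    case 0
    show ?case using diam[OF XB XB] by simp
  next
    case (Suc k)
    have "norm (\<Phi> (X (k + m)) i - \<Phi> (X k) i) \<le> \<theta> * (\<theta> ^ k * M) * w i"
      by (rule contr) (use XB Suc M \<theta> in auto)
    thus ?case by (simp add: XS mult_ac)
  qed
  have wpos: "0 \<le> M * w i" for i using diam[OF x0 x0, of i] by simp
  have lim0: "(\<lambda>k. \<theta> ^ k * M * w i) \<longlonglongrightarrow> 0" for i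
    using tendsto_mult_right[OF LIMSEQ_realpow_zero[OF \<theta>], of "M * w i"] by (simp add: mult_ac)
  have cau: "Cauchy (\<lambda>k. X k i)" for i
  proof (rule metric_CauchyI)
    fix e :: real assume "e > 0"
    then obtain k where k: "\<theta> ^ k * M * w i < e / 2"
      using order_tendstoD(2)[OF lim0[of i], of "e / 2"] by (auto simp: eventually_sequentially)
    have "dist (X m i) (X k i) < e / 2" if "m \<ge> k" for m
      using gap[of k "m - k" i] k that by (simp add: dist_norm)
    then show "\<exists>k. \<forall>m\<ge>k. \<forall>n\<ge>k. dist (X m i) (X n i) < e"
      using dist_triangle_half_l[of "X _ i" "X k i" e] by (intro exI[of _ k]) (simp add: dist_commute)
  qed
  define x where "x i = lim (\<lambda>k. X k i)" for i
  have lim: "(\<lambda>k. X k i) \<longlonglongrightarrow> x i" for i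
    unfolding x_def using cau[of i] by (metis Cauchy_convergent_iff convergent_LIMSEQ_iff)
  have xB: "x i \<in> B i" for i
    using closed_sequentially[OF closed, of "\<lambda>k. X k i"] XB lim by blast
  \<comment> \<open>Coordinatewise convergence alone would not allow passing to the limit in
    \<open>\<Phi>\<close>; \<open>contr\<close> requires one constant for all coordinates at once,
    and this bound supplies it.\<close>
  have gap': "norm (x i - X k i) \<le> (\<theta> ^ k * M) * w i" for k i
  proof (rule Lim_bounded)
    show "(\<lambda>m. norm (X m i - X k i)) \<longlonglongrightarrow> norm (x i - X k i)"
      by (intro tendsto_intros lim)
    show "\<forall>m\<ge>k. norm (X m i - X k i) \<le> \<theta> ^ k * M * w i"
      using gap[of k _ i] by (metis le_add_diff_inverse)
  qed
  have "norm (\<Phi> x i - X (Suc k) i) \<le> \<theta> ^ Suc k * M * w i" for k i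
    using contr[OF xB, of "X k" "\<theta> ^ k * M" i] XB gap' M \<theta> by (simp add: XS mult_ac)
  hence "(\<lambda>k. norm (\<Phi> x i - X (Suc k) i)) \<longlonglongrightarrow> 0" for i
    by (intro tendsto_sandwich[OF _ _ tendsto_const LIMSEQ_Suc[OF lim0[of i]]]) auto
  moreover have "(\<lambda>k. norm (\<Phi> x i - X (Suc k) i)) \<longlonglongrightarrow> norm (\<Phi> x i - x i)" for i
    by (intro tendsto_intros LIMSEQ_Suc lim)
  ultimately have "norm (\<Phi> x i - x i) = 0" for i
    using LIMSEQ_unique by blast
  hence "\<Phi> x = x" by auto
  with xB show ?thesis using that by blast
qed

text \<open>The convention 1/0 = 0 removes the term m = n. The indices below and above n each
  contribute at most \<pi>^2/6, which \<pi> < 4 bounds by 3.\<close>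

lemma inverse_square_distances:
  fixes n :: nat
  shows "summable (\<lambda>m. 1 / (real m - real n)\<^sup>2)" and "(\<Sum>m. 1 / (real m - real n)\<^sup>2) \<le> 6"
proof -
  define z where "z k = 1 / (real k + 1)\<^sup>2" for k :: nat
  have z: "z sums (pi\<^sup>2 / 6)" using inverse_squares_sums unfolding z_def by (simp add: add_ac)
  have "pi\<^sup>2 < 4\<^sup>2" by (intro power_strict_mono) (use pi_less_4 in auto)
  hence z3: "suminf z \<le> 3" using sums_unique[OF z] by simp
  let ?f = "\<lambda>m. 1 / (real m - real n)\<^sup>2"
  have shift: "?f (m + Suc n) = z m" for m by (simp add: z_def)
  have "summable (\<lambda>m. ?f (m + Suc n))"
    unfolding shift using z sums_summable by auto
  thus sm: "summable ?f" using summable_iff_shift[of ?f "Suc n"] by blast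
  have "(\<Sum>m<n. ?f m) = (\<Sum>k<n. z k)"
  proof -
    have "(\<Sum>k<n. z k) = (\<Sum>m<n. z (n - Suc m))" by (rule sum.nat_diff_reindex[symmetric])
    also have "\<dots> = (\<Sum>m<n. ?f m)"
      by (intro sum.cong) (auto simp: z_def of_nat_diff power2_commute)
    finally show ?thesis by simp
  qed
  also have "\<dots> \<le> suminf z"
    by (intro sum_le_suminf sums_summable[OF z]) (auto simp: z_def)
  finally have "(\<Sum>m<Suc n. ?f m) \<le> 3" using z3 by simp
  moreover have "(\<Sum>m. ?f (m + Suc n)) \<le> 3" unfolding shift by (rule z3)
  ultimately show "suminf ?f \<le> 6"
    using suminf_split_initial_segment[OF sm, of "Suc n"] by simp
qed

text \<open>At m = n the right side of the hypothesis is C / 0 = 0, so it forces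
  \<open>F n = 0\<close>: this is the form of a sum over all poles but one.\<close>

lemma norm_suminf_inverse_square_le:
  fixes F :: "nat \<Rightarrow> complex"
  assumes "\<And>m. norm (F m) \<le> C / (real m - real n)\<^sup>2"
  shows "summable F" and "norm (suminf F) \<le> 6 * C"
proof -
  have sm: "summable (\<lambda>m. C / (real m - real n)\<^sup>2)"
    using summable_mult[OF inverse_square_distances(1), of C n] by simp
  show "summable F" by (rule summable_comparison_test'[OF sm]) (use assms in auto)
  have C: "C \<ge> 0" using order_trans[OF norm_ge_zero assms[of "Suc n"]] by simp
  have "norm (suminf F) \<le> (\<Sum>m. C / (real m - real n)\<^sup>2)"
    by (intro norm_suminf_le sm assms)
  also have "\<dots> = C * (\<Sum>m. 1 / (real m - real n)\<^sup>2)"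
    using suminf_mult[OF inverse_square_distances(1), of C n] by simp
  also have "\<dots> \<le> C * 6" by (intro mult_left_mono inverse_square_distances(2) C)
  finally show "norm (suminf F) \<le> 6 * C" by simp
qed

lemma norm_divide_diff_le:
  fixes a b :: complex
  assumes "norm (a - a') \<le> \<alpha>" "norm a' \<le> A" "norm (b - b') \<le> \<beta>"
    and "norm b \<ge> D" "norm b' \<ge> D'" "D > 0" "D' > 0"
  shows "norm (a / b - a' / b') \<le> \<alpha> / D + A * \<beta> / (D * D')"
proof -
  have nz: "b \<noteq> 0" "b' \<noteq> 0" using assms by auto
  have "norm (a / b - a' / b') = norm ((a - a') / b - a' * (b - b') / (b * b'))"
    using nz by (simp add: field_simps)
  also have "\<dots> \<le> norm (a - a') / norm b + norm a' * norm (b - b') / (norm b * norm b')"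
    by (rule order_trans[OF norm_triangle_ineq4]) (simp add: norm_mult norm_divide)
  also have "\<dots> \<le> \<alpha> / D + A * \<beta> / (D * D')"
    using assms order_trans[OF norm_ge_zero assms(1)] order_trans[OF norm_ge_zero assms(2)]
      order_trans[OF norm_ge_zero assms(3)]
    by (intro add_mono frac_le mult_mono) auto
  finally show ?thesis .
qed

lemma norm_mult_diff_le:
  fixes a b :: complex
  assumes "norm (a - a') \<le> \<alpha>" "norm b \<le> D" "norm a' \<le> A" "norm (b - b') \<le> \<beta>"
  shows "norm (a * b - a' * b') \<le> \<alpha> * D + A * \<beta>"
proof -
  have "norm (a * b - a' * b') = norm ((a - a') * b + a' * (b - b'))" by (simp add: algebra_simps)
  also have "\<dots> \<le> norm (a - a') * norm b + norm a' * norm (b - b')"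
    by (rule order_trans[OF norm_triangle_ineq]) (simp add: norm_mult)
  also have "\<dots> \<le> \<alpha> * D + A * \<beta>"
    using assms order_trans[OF norm_ge_zero assms(1)] order_trans[OF norm_ge_zero assms(2)]
      order_trans[OF norm_ge_zero assms(3)]
    by (intro add_mono mult_mono) auto
  finally show ?thesis .
qed

subsection \<open>The nominal positions of the poles\<close>

text \<open>
  Poles are indexed like the nodes of a binary heap. Pole \<open>n\<close> has two critical points nearby, with
  indices \<open>j = 2 n\<close> (to the left, sign -1) and \<open>j = 2 n + 1\<close> (to the right, sign 1); the critical
  value belonging to critical point \<open>j\<close> lies next to pole \<open>j + 1\<close>.
\<close>

definition sg :: "nat \<Rightarrow> complex" where "sg j = (if even j then -1 else 1)"

lemma sg_mult_self [simp]: "sg j * sg j = 1" "sg j * (sg j * x) = x" and norm_sg [simp]: "norm (sg j) = 1"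
  by (auto simp: sg_def)

fun heap :: "nat \<Rightarrow> int" where
  "heap 0 = 1"
| "heap (Suc j) = 1000000 * heap (j div 2) + (if even j then -1 else 1)"

text \<open>Passing to a child roughly doubles the index but multiplies the value by 10^6, so
  quadratic growth persists with much to spare. Quadratic is enough because inverse squares are
  summable.\<close>

lemma heap_ge: "heap n \<ge> (int n + 1)\<^sup>2"
proof (induction n rule: heap.induct)
  case (2 j)
  define a where "a = j div 2"
  have j: "j \<le> 2 * a + 1" unfolding a_def by linarith
  have "(int (Suc j) + 1)\<^sup>2 \<le> (2 * int a + 3)\<^sup>2" using j by (intro power_mono) auto
  also have "\<dots> \<le> 1000000 * (int a + 1)\<^sup>2 - 1"
    by (simp add: power2_eq_square algebra_simps)
  also have "\<dots> \<le> heap (Suc j)" using 2 by (auto simp: a_def)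
  finally show ?case .
qed simp

text \<open>Children of distinct parents inherit 10^6 times the parents' distance, less at most 2
  for the signs, while the index gap grows from d to at most 2 d + 1. Siblings differ by 2 with
  index gap 1, and the root is covered by \<open>heap_ge\<close>.\<close>

lemma heap_separated: "\<bar>heap n - heap m\<bar> \<ge> (int n - int m)\<^sup>2"
proof (induction n arbitrary: m rule: less_induct)
  case (less n)
  consider "n = 0" | "m = 0" | i j where "n = Suc i" "m = Suc j" by (metis not0_implies_Suc)
  then show ?case
  proof cases
    case 1
    then show ?thesis using heap_ge[of m] by (auto simp: power2_eq_square algebra_simps)
  next
    case 2
    then show ?thesis using heap_ge[of n] by (auto simp: power2_eq_square algebra_simps)
  next
    case 3
    define a b where "a = i div 2" and "b = j div 2"
    have IH: "\<bar>heap a - heap b\<bar> \<ge> (int a - int b)\<^sup>2"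
      using less[of a b] 3 by (simp add: a_def)
    define d where "d = \<bar>int a - int b\<bar>"
    obtain e e' where ij: "i = 2 * a + e" "j = 2 * b + e'" "e < 2" "e' < 2"
      unfolding a_def b_def by (metis mult_div_mod_eq mod_less_divisor zero_less_numeral)
    show ?thesis
    proof (cases "d = 0")
      case True
      hence "a = b" by (simp add: d_def)
      then have "i = j \<or> (even i \<noteq> even j \<and> \<bar>int i - int j\<bar> = 1)"
        using ij by simp presburger
      then show ?thesis
      proof
        assume h: "even i \<noteq> even j \<and> \<bar>int i - int j\<bar> = 1"
        have "(int n - int m)\<^sup>2 = \<bar>int i - int j\<bar>\<^sup>2" using 3 by simp
        also have "\<dots> = 1" using h by simp
        finally have "(int n - int m)\<^sup>2 = 1" .
        thus ?thesis using h \<open>a = b\<close> 3 by (auto simp: a_def b_def)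
      qed (use 3 in auto)
    next
      case False
      hence d1: "d \<ge> 1" by (simp add: d_def)
      have "int n - int m = 2 * (int a - int b) + (int e - int e')" using 3 ij(1,2) by simp
      moreover have "\<bar>int e - int e'\<bar> \<le> 1" using ij(3,4) by simp
      ultimately have "\<bar>int n - int m\<bar> \<le> 2 * d + 1"
        using abs_triangle_ineq[of "2 * (int a - int b)" "int e - int e'"] 
          abs_mult[of 2 "int a - int b"] unfolding d_def by linarith
      hence "(int n - int m)\<^sup>2 \<le> (2 * d + 1)\<^sup>2" by (metis abs_ge_zero power2_abs power_mono)
      also have "(2 * d + 1)\<^sup>2 = 4 * d\<^sup>2 + 4 * d + 1" by (simp add: power2_eq_square algebra_simps)
      also have "\<dots> \<le> 1000000 * d\<^sup>2 - 2"
        using d1 self_le_power[OF d1, of 2] by linarith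
      also have "d\<^sup>2 = (int a - int b)\<^sup>2" by (simp add: d_def)
      also have "1000000 * (int a - int b)\<^sup>2 - 2 \<le> 1000000 * \<bar>heap a - heap b\<bar> - 2" using IH by simp
      also have "\<dots> \<le> \<bar>heap n - heap m\<bar>" using 3 by (auto simp: a_def b_def abs_if)
      finally show ?thesis .
    qed
  qed
qed

text \<open>
  The map \<open>z \<mapsto> \<lambda> (z + 1 / (z - q))\<close> has the critical values \<open>\<lambda> (q \<plusminus> 2)\<close>. With \<open>\<lambda> = 10\<^sup>6\<close> and
  \<open>q = 2 \<lambda> h\<close> these are \<open>2 \<lambda> (\<lambda> h \<plusminus> 1)\<close>, which is where the recursion for \<^const>\<open>heap\<close> comes from.
\<close>

definition base :: "nat \<Rightarrow> complex" where "base n = of_int (2000000 * heap n)"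

lemma base_Suc: "base (Suc j) = 1000000 * (base (j div 2) + 2 * sg j)"
  by (simp add: base_def sg_def algebra_simps)

lemma base_separated: "norm (base n - base m) \<ge> 2000000 * (real m - real n)\<^sup>2"
proof -
  have "norm (base n - base m) = 2000000 * real_of_int \<bar>heap n - heap m\<bar>"
    unfolding base_def of_int_diff[symmetric] right_diff_distrib[symmetric] norm_of_int
    by (simp only: abs_mult of_int_mult of_int_abs)
  moreover have "real_of_int ((int n - int m)\<^sup>2) \<le> real_of_int \<bar>heap n - heap m\<bar>"
    using heap_separated[of n m] by (simp only: of_int_le_iff)
  ultimately show ?thesis by (simp add: power2_commute)
qed

lemma Re_base_ge: "Re (base n) \<ge> 2000000 * (real n + 1)\<^sup>2"
proof -
  have "real_of_int ((int n + 1)\<^sup>2) \<le> real_of_int (heap n)" using heap_ge[of n] by (simp only: of_int_le_iff)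
  thus ?thesis by (simp add: base_def)
qed

subsection \<open>The configuration as a fixed point\<close>

definition near :: "(nat \<Rightarrow> complex) \<Rightarrow> (nat \<Rightarrow> complex) \<Rightarrow> bool" where
  "near p s \<longleftrightarrow> (\<forall>m. norm (p m - base m) \<le> 1/1000 \<and> norm (s m - 1) \<le> 1/1000)"

text \<open>Expresses that pole \<open>n\<close> is the only one that may be close to
  \<open>x\<close>; for m = n the condition is void, so \<open>x\<close> may even be that pole. The
  constant is half of the separation 10^6 of the actual poles, which is what a nearest pole
  guarantees.\<close>

definition apart :: "(nat \<Rightarrow> complex) \<Rightarrow> nat \<Rightarrow> complex \<Rightarrow> bool" where
  "apart p n x \<longleftrightarrow> (\<forall>m. norm (x - p m) \<ge> 500000 * (real m - real n)\<^sup>2)"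

text \<open>Up to the factor 10^6, k = 1 gives the contribution of the other poles to the function,
  and k = 2 gives minus their contribution to its derivative.\<close>

definition tail :: "nat \<Rightarrow> (nat \<Rightarrow> complex) \<Rightarrow> (nat \<Rightarrow> complex) \<Rightarrow> nat \<Rightarrow> complex \<Rightarrow> complex" where
  "tail k p s n x = (\<Sum>m. if m = n then 0 else (s m)\<^sup>2 / (x - p m) ^ k)"

lemma square_distance_ge_1: "m \<noteq> n \<Longrightarrow> 1 \<le> (real m - real n)\<^sup>2"
proof -
  assume "m \<noteq> n"
  hence "1 \<le> \<bar>real m - real n\<bar>" by linarith
  thus ?thesis by (metis one_le_power power2_abs)
qed

lemma near_norm_s: "near p s \<Longrightarrow> norm (s m) \<le> 1001/1000"
  using norm_triangle_ineq2[of "s m" 1] by (force simp: near_def dest: spec[of _ m])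

lemma near_norm_s2: "near p s \<Longrightarrow> norm ((s m)\<^sup>2) \<le> 2"
  using power_mono[OF near_norm_s[of p s m], of 2] by (simp add: norm_power norm_mult power2_eq_square)

lemma apartI:
  assumes "near p s" "norm (x - base n) \<le> 2"
  shows "apart p n x"
  unfolding apart_def
proof
  fix m
  show "500000 * (real m - real n)\<^sup>2 \<le> norm (x - p m)"
  proof (cases "m = n")
    case False
    have "norm (base n - base m) \<le> norm (x - p m) + norm (x - base n) + norm (p m - base m)"
      by norm
    moreover have "norm (p m - base m) \<le> 1/1000" using assms by (simp add: near_def)
    ultimately show ?thesis
      using assms(2) base_separated[of m n] square_distance_ge_1[OF False] by linarith
  qed simp
qed

lemma apart_ge:
  assumes "apart p n x" "m \<noteq> n"
  shows "norm (x - p m) \<ge> 500000 * (real m - real n)\<^sup>2" "norm (x - p m) \<ge> 1"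
proof -
  show *: "norm (x - p m) \<ge> 500000 * (real m - real n)\<^sup>2" using assms by (auto simp: apart_def)
  show "norm (x - p m) \<ge> 1" using * square_distance_ge_1[OF assms(2)] by linarith
qed

lemma tail_term_le:
  assumes "near p s" "apart p n x" "k > 0"
  shows "norm (if m = n then 0 else (s m)\<^sup>2 / (x - p m) ^ k) \<le> (2/500000) / (real m - real n)\<^sup>2"
proof (cases "m = n")
  case False
  note a = apart_ge[OF assms(2) False]
  have "norm ((s m)\<^sup>2 / (x - p m) ^ k) = norm ((s m)\<^sup>2) / norm (x - p m) ^ k"
    by (simp add: norm_divide norm_power)
  also have "\<dots> \<le> 2 / (500000 * (real m - real n)\<^sup>2)"
    using near_norm_s2[OF assms(1), of m] a square_distance_ge_1[OF False]
      self_le_power[OF a(2) assms(3)]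
    by (intro frac_le) auto
  finally show ?thesis using False by simp
qed simp

lemma tail_summable:
  assumes "near p s" "apart p n x" "k > 0"
  shows "summable (\<lambda>m. if m = n then 0 else (s m)\<^sup>2 / (x - p m) ^ k)"
  using norm_suminf_inverse_square_le(1)[OF tail_term_le[OF assms]] .

lemma tail_le:
  assumes "near p s" "apart p n x" "k > 0"
  shows "norm (tail k p s n x) \<le> 1/40000"
  using norm_suminf_inverse_square_le(2)[OF tail_term_le[OF assms]] by (simp add: tail_def)

text \<open>The other poles are so remote that their sum depends on all parameters with a tiny
  Lipschitz constant. The point may move by \<open>4 * K\<close>, matching the largest weight used
  below.\<close>

lemma tail_diff_le:
  assumes ps: "near p s" "near p' s'" and x: "apart p n x" "apart p' n x'"
    and K: "K \<ge> 0" "norm (x - x') \<le> 4 * K" "\<And>m. norm (p m - p' m) \<le> K" "\<And>m. norm (s m - s' m) \<le> K"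
    and k: "k = 1 \<or> k = 2"
  shows "norm (tail k p s n x - tail k p' s' n x') \<le> K / 1000"
proof -
  let ?F = "\<lambda>p s x m. if m = n then 0 else (s m)\<^sup>2 / (x - p m) ^ k"
  have k0: "k > 0" using k by auto
  have le: "norm (?F p s x m - ?F p' s' x' m) \<le> (23 * K / 500000) / (real m - real n)\<^sup>2" for m
  proof (cases "m = n")
    case False
    define d where "d = (real m - real n)\<^sup>2"
    have d: "d \<ge> 1" unfolding d_def by (rule square_distance_ge_1[OF False])
    note a = apart_ge[OF x(1) False, folded d_def] and a' = apart_ge[OF x(2) False, folded d_def]
    have "norm ((x - p m) - (x' - p' m)) \<le> norm (x - x') + norm (p m - p' m)" by norm
    hence b: "norm ((x - p m) - (x' - p' m)) \<le> 5 * K" using K(2) K(3)[of m] by linarith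
    have "(s m)\<^sup>2 - (s' m)\<^sup>2 = (s m - s' m) * (s m + s' m)" by (simp add: power2_eq_square algebra_simps)
    hence "norm ((s m)\<^sup>2 - (s' m)\<^sup>2) = norm (s m - s' m) * norm (s m + s' m)" by (simp add: norm_mult)
    also have "\<dots> \<le> K * 3"
      using K(4)[of m] near_norm_s[OF ps(1), of m] near_norm_s[OF ps(2), of m]
        norm_triangle_ineq[of "s m" "s' m"] by (intro mult_mono) (auto simp: K)
    finally have s: "norm ((s m)\<^sup>2 - (s' m)\<^sup>2) \<le> 3 * K" by simp
    \<comment> \<open>One of the two denominators is bounded below only by 1: a single factor
      \<open>d\<close> already makes the series summable.\<close>
    have "norm ((s m)\<^sup>2 / (x - p m) - (s' m)\<^sup>2 / (x' - p' m))
        \<le> 3 * K / (500000 * d) + 2 * (5 * K) / ((500000 * d) * 1)"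
      by (rule norm_divide_diff_le[OF s near_norm_s2[OF ps(2)] b a(1) a'(2)]) (use d in auto)
    also have "\<dots> = 13 * K / (500000 * d)" using d by (simp add: field_simps)
    finally have q: "norm ((s m)\<^sup>2 / (x - p m) - (s' m)\<^sup>2 / (x' - p' m)) \<le> 13 * K / (500000 * d)" .
    show ?thesis
    proof (cases "k = 1")
      case True
      then show ?thesis using q False d K(1) by (simp add: d_def field_simps)
    next
      case 2: False
      have "norm ((s' m)\<^sup>2 / (x' - p' m)) \<le> 2 / 1"
        unfolding norm_divide using near_norm_s2[OF ps(2)] a'(2) by (intro frac_le) auto
      \<comment> \<open>The quotient just estimated is divided once more by the same denominator,
        which adds a further 10 to the constant 13.\<close>
      hence "norm ((s m)\<^sup>2 / (x - p m) / (x - p m) - (s' m)\<^sup>2 / (x' - p' m) / (x' - p' m))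
          \<le> (13 * K / (500000 * d)) / 1 + (2 / 1) * (5 * K) / (1 * (500000 * d))"
        by (rule norm_divide_diff_le[OF q _ b a(2) a'(1)]) (use d in auto)
      also have "\<dots> = (23 * K / 500000) / d" using d by (simp add: field_simps)
      finally show ?thesis using 2 k False by (simp add: d_def power2_eq_square)
    qed
  qed simp
  have "tail k p s n x - tail k p' s' n x' = (\<Sum>m. ?F p s x m - ?F p' s' x' m)"
    unfolding tail_def using tail_summable ps x k0 by (intro suminf_diff) auto
  also have "norm \<dots> \<le> 6 * (23 * K / 500000)"
    by (rule norm_suminf_inverse_square_le(2)[OF le])
  also have "\<dots> \<le> K / 1000" using K(1) by simp
  finally show ?thesis .
qed

lemma norm_diff3_le:
  fixes a :: complex
  assumes "norm (a - a') \<le> \<alpha>" "norm (b - b') \<le> \<beta>" "norm (c - c') \<le> \<gamma>"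
  shows "norm ((a - b - c) - (a' - b' - c')) \<le> \<alpha> + \<beta> + \<gamma>"
    and "norm ((a + b - c) - (a' + b' - c')) \<le> \<alpha> + \<beta> + \<gamma>"
  using assms by norm+

lemma norm_add3_le: "norm (a + b + c) \<le> norm a + norm b + norm (c :: complex)"
  by norm

text \<open>
  The unknowns: the poles, square roots of their residues divided by \<open>10\<^sup>6\<close>, the critical points and
  the critical values.
\<close>

datatype coord = Pole nat | Root nat | Crit nat | Val nat

fun centre :: "coord \<Rightarrow> complex" where
  "centre (Pole n) = base n" | "centre (Root n) = 1"
| "centre (Crit j) = base (j div 2) + sg j" | "centre (Val j) = base (Suc j)"

text \<open>A box of radius 1 is affordable for the critical values because \<open>branch\<close>
  divides them by 1000000.\<close>

fun radius :: "coord \<Rightarrow> real" where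
  "radius (Pole n) = 1/1000" | "radius (Root n) = 1/1000"
| "radius (Crit j) = 4/1000" | "radius (Val j) = 1"

text \<open>A critical point follows its pole and its root at full rate and has a small correction,
  in all at most \<open>3 * K\<close>; weight 4 turns this into the contraction factor 3/4. A
  critical value follows its pole with error at most 11/10 of \<open>K\<close>, for which weight 2
  suffices.\<close>

fun weight :: "coord \<Rightarrow> real" where
  "weight (Pole n) = 1" | "weight (Root n) = 1" | "weight (Crit j) = 4" | "weight (Val j) = 2"

definition boxed :: "(coord \<Rightarrow> complex) \<Rightarrow> bool" where
  "boxed X \<longleftrightarrow> (\<forall>i. norm (X i - centre i) \<le> radius i)"

abbreviation coord_tail :: "nat \<Rightarrow> (coord \<Rightarrow> complex) \<Rightarrow> nat \<Rightarrow> complex \<Rightarrow> complex" where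
  "coord_tail k X \<equiv> tail k (\<lambda>n. X (Pole n)) (\<lambda>n. X (Root n))"

definition offset :: "(coord \<Rightarrow> complex) \<Rightarrow> nat \<Rightarrow> complex" where
  "offset X j = sg j * (X (Crit j) - X (Pole (j div 2)))"

definition branch :: "(coord \<Rightarrow> complex) \<Rightarrow> nat \<Rightarrow> complex" where
  "branch X j = X (Val j) / 1000000 - coord_tail 1 X (j div 2) (X (Crit j))
     - sg j * ((offset X j - X (Root (j div 2)))\<^sup>2 / offset X j)"

text \<open>
  Let \<open>t = sg j (c - p)\<close> be the offset of a critical point and \<open>T, E\<close> the two tail sums at \<open>c\<close>. From
  \<open>t + s\<^sup>2 / t = 2 s + (t - s)\<^sup>2 / t\<close>, the equation \<open>f c = v\<close> becomes \<open>p + 2 sg j s = branch j\<close>, and its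
  instances at \<open>2 n\<close> and \<open>2 n + 1\<close> are solved for \<open>p\<close> and \<open>s\<close>. Thus the children of a pole determine the
  pole, which turns the expansion by \<open>10\<^sup>6\<close> into a contraction. The equation \<open>f' c = 0\<close>, that is
  \<open>t\<^sup>2 (1 - E) = s\<^sup>2\<close>, is written as \<open>t = s + t\<^sup>2 E / (t + s)\<close>, and \<open>f v = c\<close> is solved for \<open>v\<close>.
\<close>

fun step :: "(coord \<Rightarrow> complex) \<Rightarrow> coord \<Rightarrow> complex" where
  "step X (Pole n) = (branch X (2 * n + 1) + branch X (2 * n)) / 2"
| "step X (Root n) = (branch X (2 * n + 1) - branch X (2 * n)) / 4"
| "step X (Crit j) = X (Pole (j div 2)) + sg j * X (Root (j div 2)) +
     sg j * ((offset X j)\<^sup>2 * coord_tail 2 X (j div 2) (X (Crit j)) / (offset X j + X (Root (j div 2))))"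
| "step X (Val j) = X (Pole (Suc j)) -
     (X (Root (Suc j)))\<^sup>2 / (X (Val j) + coord_tail 1 X (Suc j) (X (Val j)) - X (Crit j) / 1000000)"

section \<open>The iteration preserves the boxes and contracts\<close>

lemma boxedD:
  assumes "boxed X"
  shows "norm (X (Pole n) - base n) \<le> 1/1000" "norm (X (Root n) - 1) \<le> 1/1000"
    "norm (X (Crit j) - (base (j div 2) + sg j)) \<le> 4/1000" "norm (X (Val j) - base (Suc j)) \<le> 1"
  using assms[unfolded boxed_def, rule_format, of "Pole n"] assms[unfolded boxed_def, rule_format, of "Root n"]
    assms[unfolded boxed_def, rule_format, of "Crit j"] assms[unfolded boxed_def, rule_format, of "Val j"]
  by simp_all

lemma boxed_near: "boxed X \<Longrightarrow> near (\<lambda>n. X (Pole n)) (\<lambda>n. X (Root n))"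
  using boxedD by (simp add: near_def)

lemma boxed_apart_Crit: "boxed X \<Longrightarrow> apart (\<lambda>n. X (Pole n)) (j div 2) (X (Crit j))"
proof (rule apartI[OF boxed_near])
  assume "boxed X"
  have "norm (X (Crit j) - base (j div 2)) \<le> norm (X (Crit j) - (base (j div 2) + sg j)) + norm (sg j)"
    by norm
  thus "norm (X (Crit j) - base (j div 2)) \<le> 2" using boxedD(3)[OF \<open>boxed X\<close>, of j] by simp
qed auto

lemma boxed_apart_Val: "boxed X \<Longrightarrow> apart (\<lambda>n. X (Pole n)) (Suc j) (X (Val j))"
  using boxedD(4)[of X j] by (intro apartI[OF boxed_near]) auto

lemma boxed_offset:
  assumes "boxed X"
  shows "norm (offset X j - 1) \<le> 5/1000" "norm (offset X j - X (Root (j div 2))) \<le> 6/1000"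
    "norm (offset X j) \<ge> 99/100" "norm (offset X j) \<le> 101/100" "norm (offset X j + X (Root (j div 2))) \<ge> 19/10"
proof -
  have "offset X j - 1 = sg j * ((X (Crit j) - (base (j div 2) + sg j)) - (X (Pole (j div 2)) - base (j div 2)))"
    by (simp add: offset_def algebra_simps)
  also have "norm \<dots> \<le> norm (X (Crit j) - (base (j div 2) + sg j)) + norm (X (Pole (j div 2)) - base (j div 2))"
    unfolding norm_mult norm_sg mult_1_left by (rule norm_triangle_ineq4)
  finally show *: "norm (offset X j - 1) \<le> 5/1000"
    using boxedD(1)[OF assms, of "j div 2"] boxedD(3)[OF assms, of j] by linarith
  have r: "norm (X (Root (j div 2)) - 1) \<le> 1/1000" by (rule boxedD(2)[OF assms])
  show "norm (offset X j - X (Root (j div 2))) \<le> 6/1000" using * r by norm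
  have "norm (1::complex) = 1" "norm (2::complex) = 2" by auto
  with norm_triangle_sub[of "offset X j" 1] norm_triangle_sub[of 1 "offset X j"]
  show "norm (offset X j) \<ge> 99/100" "norm (offset X j) \<le> 101/100" using * by (simp_all add: norm_minus_commute)
  have "norm (c + c) \<le> norm (a + b) + norm (a - c) + norm (b - c)" for a b c :: complex
    by norm
  from this[of 1 "offset X j" "X (Root (j div 2))"]
  have "norm (1 + 1::complex) \<le> norm (offset X j + X (Root (j div 2))) + norm (offset X j - 1) + norm (X (Root (j div 2)) - 1)" .
  thus "norm (offset X j + X (Root (j div 2))) \<ge> 19/10" using * r by simp
qed

text \<open>\<open>base_Suc\<close> makes the nominal critical value, divided by 10^6, equal to
  \<open>base (j div 2) + 2 * sg j\<close>. Three errors remain: that of the critical value divided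
  by 10^6, the tail, and a term quadratic in the small difference t - s.\<close>

lemma boxed_branch:
  assumes "boxed X"
  shows "norm (branch X j - (base (j div 2) + 2 * sg j)) \<le> 1/10000"
proof -
  have "norm ((offset X j - X (Root (j div 2)))\<^sup>2 / offset X j) \<le> (6/1000)\<^sup>2 / (99/100)"
    unfolding norm_divide norm_power using boxed_offset[OF assms, of j] by (intro frac_le power_mono) auto
  hence d: "norm (sg j * ((offset X j - X (Root (j div 2)))\<^sup>2 / offset X j)) \<le> 37/1000000"
    unfolding norm_mult by (simp add: power2_eq_square)
  have v: "X (Val j) / 1000000 - (base (j div 2) + 2 * sg j) = (X (Val j) - base (Suc j)) / 1000000"
    by (simp add: base_Suc field_simps)
  have v: "norm (X (Val j) / 1000000 - (base (j div 2) + 2 * sg j)) \<le> 1/1000000"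
    unfolding v norm_divide using boxedD(4)[OF assms, of j] by simp
  have t: "norm (coord_tail 1 X (j div 2) (X (Crit j))) \<le> 1/40000"
    by (rule tail_le[OF boxed_near boxed_apart_Crit]) (use assms in auto)
  have "norm (branch X j - ((base (j div 2) + 2 * sg j) - 0 - 0)) \<le> 1/1000000 + 1/40000 + 37/1000000"
    unfolding branch_def by (rule norm_diff3_le(1)) (use d v t in auto)
  thus ?thesis by simp
qed

lemma base_ge: "norm (base n) \<ge> 2000000"
proof -
  have "1 \<le> (real n + 1)\<^sup>2" by (intro one_le_power) auto
  thus ?thesis using Re_base_ge[of n] complex_Re_le_cmod[of "base n"] by linarith
qed

text \<open>The critical value has size about 10^6 times the modulus of the parent's position and
  swamps the other terms. The quotient by this denominator is the distance between critical value
  and pole, so the two nearly coincide.\<close>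

lemma boxed_Val_denominator:
  assumes "boxed X"
  shows "norm (X (Val j) + coord_tail 1 X (Suc j) (X (Val j)) - X (Crit j) / 1000000) \<ge> 1000"
proof -
  let ?b = "base (j div 2)"
  define D where "D = X (Val j) + coord_tail 1 X (Suc j) (X (Val j)) - X (Crit j) / 1000000"
  have t: "norm (coord_tail 1 X (Suc j) (X (Val j))) \<le> 1/40000"
    by (rule tail_le[OF boxed_near boxed_apart_Val]) (use assms in auto)
  have "norm (X (Crit j)) \<le> norm (X (Crit j) - (?b + sg j)) + norm ?b + norm (sg j)" by norm
  hence c: "norm (X (Crit j)) \<le> norm ?b + 2" using boxedD(3)[OF assms, of j] by simp
  have "norm (X (Crit j) / 1000000) = norm (X (Crit j)) / 1000000" by (simp add: norm_divide)
  moreover have "norm (1000000 * ?b) = 1000000 * norm ?b" "norm (2000000 * sg j) = 2000000"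
    by (simp_all add: norm_mult)
  moreover have b: "1000000 * ?b = base (Suc j) - 2000000 * sg j" by (simp add: base_Suc algebra_simps)
  have "norm (1000000 * ?b) \<le> norm D + norm (2000000 * sg j) + norm (X (Val j) - base (Suc j))
      + norm (coord_tail 1 X (Suc j) (X (Val j))) + norm (X (Crit j) / 1000000)"
  proof -
    have "norm (x - y) \<le> norm (v + t - e) + norm y + norm (v - x) + norm t + norm e"
      for v t e x y :: complex by norm
    thus ?thesis unfolding D_def b .
  qed
  ultimately have "norm D \<ge> 1000" using t c boxedD(4)[OF assms, of j] base_ge[of "j div 2"] by linarith
  thus ?thesis by (simp add: D_def)
qed

lemma boxed_step:
  assumes "boxed X"
  shows "norm (step X i - centre i) \<le> radius i"
proof (cases i)
  case (Pole n)
  have "norm (branch X (2 * n + 1) - (base n + 2)) \<le> 1/10000" "norm (branch X (2 * n) - (base n - 2)) \<le> 1/10000"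
    using boxed_branch[OF assms, of "2 * n + 1"] boxed_branch[OF assms, of "2 * n"] by (simp_all add: sg_def)
  from norm_triangle_mono[OF this]
  have "norm (branch X (2 * n + 1) + branch X (2 * n) - 2 * base n) \<le> 2/10000" by (simp add: algebra_simps)
  moreover have "step X (Pole n) - base n = (branch X (2 * n + 1) + branch X (2 * n) - 2 * base n) / 2"
    by (simp add: field_simps)
  ultimately have "norm (step X (Pole n) - base n) \<le> 1/1000" by (simp only: norm_divide) simp
  thus ?thesis using Pole by simp
next
  case (Root n)
  have "norm (branch X (2 * n + 1) - (base n + 2)) \<le> 1/10000" "norm (branch X (2 * n) - (base n - 2)) \<le> 1/10000"
    using boxed_branch[OF assms, of "2 * n + 1"] boxed_branch[OF assms, of "2 * n"] by (simp_all add: sg_def)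
  from order_trans[OF norm_triangle_ineq4 add_mono[OF this]]
  have "norm (branch X (2 * n + 1) - branch X (2 * n) - 4) \<le> 2/10000" by (simp add: algebra_simps)
  moreover have "step X (Root n) - 1 = (branch X (2 * n + 1) - branch X (2 * n) - 4) / 4"
    by (simp add: field_simps)
  ultimately have "norm (step X (Root n) - 1) \<le> 1/1000" by (simp only: norm_divide) simp
  thus ?thesis using Root by simp
next
  case (Crit j)
  define n where "n = j div 2"
  define e where "e = sg j * ((offset X j)\<^sup>2 * coord_tail 2 X n (X (Crit j)) / (offset X j + X (Root n)))"
  have t: "norm (coord_tail 2 X n (X (Crit j))) \<le> 1/40000"
    unfolding n_def by (rule tail_le[OF boxed_near boxed_apart_Crit]) (use assms in auto)
  have "norm e = norm (offset X j) ^ 2 * norm (coord_tail 2 X n (X (Crit j))) / norm (offset X j + X (Root n))"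
    by (simp add: e_def norm_mult norm_divide norm_power)
  also have "\<dots> \<le> (101/100)\<^sup>2 * (1/40000) / (19/10)"
    using boxed_offset[OF assms, of j] t by (intro frac_le mult_mono power_mono) (auto simp: n_def)
  also have "\<dots> \<le> 1/10000" by (simp add: power2_eq_square)
  finally have e: "norm e \<le> 1/10000" .
  have "step X i - centre i = (X (Pole n) - base n) + sg j * (X (Root n) - 1) + e"
    by (simp add: Crit e_def n_def algebra_simps)
  also have "norm \<dots> \<le> norm (X (Pole n) - base n) + norm (sg j * (X (Root n) - 1)) + norm e"
    by (rule norm_add3_le)
  finally show ?thesis using e boxedD(1,2)[OF assms, of n] Crit by (simp add: norm_mult)
next
  case (Val j)
  define D where "D = X (Val j) + coord_tail 1 X (Suc j) (X (Val j)) - X (Crit j) / 1000000"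
  have D: "norm D \<ge> 1000" unfolding D_def by (rule boxed_Val_denominator[OF assms])
  have "norm ((X (Root (Suc j)))\<^sup>2 / D) \<le> 2 / 1000"
    unfolding norm_divide using near_norm_s2[OF boxed_near[OF assms]] D by (intro frac_le) auto
  moreover have "step X i = X (Pole (Suc j)) - (X (Root (Suc j)))\<^sup>2 / D" by (simp add: Val D_def)
  moreover have "norm (X (Pole (Suc j)) - (X (Root (Suc j)))\<^sup>2 / D - base (Suc j))
     \<le> norm (X (Pole (Suc j)) - base (Suc j)) + norm ((X (Root (Suc j)))\<^sup>2 / D)"
  proof -
    have "norm (a - d - b) \<le> norm (a - b) + norm d" for a b d :: complex by norm
    thus ?thesis .
  qed
  moreover note boxedD(1)[OF assms, of "Suc j"]
  ultimately have "norm (step X i - base (Suc j)) \<le> 1" by (simp only:)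
  thus ?thesis using Val by simp
qed

text \<open>Poles and roots react to any change only with factor 1/10, since \<open>branch\<close>
  damps every input. Critical points and values react to poles and roots at full rate, which is
  absorbed by their larger weights.\<close>

lemma step_contraction:
  assumes X: "boxed X" and Y: "boxed Y" and K: "K \<ge> 0"
    and d: "\<And>i. norm (X i - Y i) \<le> K * weight i"
  shows "norm (step X i - step Y i) \<le> 3/4 * K * weight i"
proof -
  have dP: "norm (X (Pole n) - Y (Pole n)) \<le> K" and dR: "norm (X (Root n) - Y (Root n)) \<le> K"
    and dC: "norm (X (Crit n) - Y (Crit n)) \<le> 4 * K" and dV: "norm (X (Val n) - Y (Val n)) \<le> 2 * K" for n
    using d[of "Pole n"] d[of "Root n"] d[of "Crit n"] d[of "Val n"] by simp_all
  have tC: "norm (coord_tail k X (j div 2) (X (Crit j)) - coord_tail k Y (j div 2) (Y (Crit j))) \<le> K / 1000"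
    if "k = 1 \<or> k = 2" for k j
    by (rule tail_diff_le) (use X Y K dP dR dC that in \<open>auto intro: boxed_near boxed_apart_Crit\<close>)
  have tV: "norm (coord_tail 1 X (Suc j) (X (Val j)) - coord_tail 1 Y (Suc j) (Y (Val j))) \<le> K / 1000" for j
    by (rule tail_diff_le)
      (use X Y K dP dR order_trans[OF dV mult_right_mono[of 2 4 K]] in \<open>auto intro: boxed_near boxed_apart_Val\<close>)
  have dO: "norm (offset X j - offset Y j) \<le> 5 * K" for j
  proof -
    have "offset X j - offset Y j = sg j * ((X (Crit j) - Y (Crit j)) - (X (Pole (j div 2)) - Y (Pole (j div 2))))"
      by (simp add: offset_def algebra_simps)
    also have "norm \<dots> \<le> norm (X (Crit j) - Y (Crit j)) + norm (X (Pole (j div 2)) - Y (Pole (j div 2)))"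
      unfolding norm_mult norm_sg mult_1_left by (rule norm_triangle_ineq4)
    finally show ?thesis using dC[of j] dP[of "j div 2"] by linarith
  qed
  have dB: "norm (branch X j - branch Y j) \<le> K / 10" for j
  proof -
    let ?n = "j div 2"
    let ?a = "offset X j - X (Root ?n)" and ?b = "offset Y j - Y (Root ?n)"
    note oX = boxed_offset[OF X, of j] and oY = boxed_offset[OF Y, of j]
    have ab: "norm (?a - ?b) \<le> 6 * K" using dO[of j] dR[of ?n] by norm
    \<comment> \<open>Both differences are at most 6/1000, so squaring has a small Lipschitz
      constant. This is the gain from separating \<open>2 s\<close> off
      \<open>t + s\<^sup>2 / t\<close>.\<close>
    have "norm (?a * ?a - ?b * ?b) \<le> (6 * K) * (6/1000) + (6/1000) * (6 * K)"
      by (rule norm_mult_diff_le[OF ab oX(2) oY(2) ab])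
    hence sq: "norm (?a\<^sup>2 - ?b\<^sup>2) \<le> 72 / 1000 * K" by (simp add: power2_eq_square)
    have "norm (?b\<^sup>2) \<le> (6/1000)\<^sup>2" unfolding norm_power using oY(2) by (intro power_mono) auto
    hence b2: "norm (?b\<^sup>2) \<le> 1/10000" by (simp add: power2_eq_square)
    have "norm (?a\<^sup>2 / offset X j - ?b\<^sup>2 / offset Y j)
        \<le> (72 / 1000 * K) / (99/100) + (1/10000) * (5 * K) / ((99/100) * (99/100))"
      by (rule norm_divide_diff_le[OF sq b2 dO oX(3) oY(3)]) auto
    also have "\<dots> \<le> 8/100 * K" using K by simp
    finally have q: "norm (sg j * (?a\<^sup>2 / offset X j) - sg j * (?b\<^sup>2 / offset Y j)) \<le> 8/100 * K"
      unfolding right_diff_distrib[symmetric] norm_mult by simp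
    have "norm (X (Val j) / 1000000 - Y (Val j) / 1000000) = norm (X (Val j) - Y (Val j)) / 1000000"
      by (simp add: norm_divide flip: diff_divide_distrib)
    hence v: "norm (X (Val j) / 1000000 - Y (Val j) / 1000000) \<le> K / 1000" using dV[of j] K by simp
    have "norm (branch X j - branch Y j) \<le> K / 1000 + K / 1000 + 8/100 * K"
      unfolding branch_def by (rule norm_diff3_le(1)[OF v tC q]) simp
    thus ?thesis using K by simp
  qed
  show ?thesis
  proof (cases i)
    case (Pole n)
    have "step X i - step Y i = ((branch X (2 * n + 1) - branch Y (2 * n + 1)) + (branch X (2 * n) - branch Y (2 * n))) / 2"
      using Pole by (simp add: field_simps)
    hence "norm (step X i - step Y i) = norm ((branch X (2 * n + 1) - branch Y (2 * n + 1)) + (branch X (2 * n) - branch Y (2 * n))) / 2"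
      by (simp only: norm_divide) simp
    also have "\<dots> \<le> (K / 10 + K / 10) / 2"
      using norm_triangle_mono[OF dB[of "2 * n + 1"] dB[of "2 * n"]] by simp
    also have "\<dots> \<le> 3/4 * K * weight i" using K Pole by simp
    finally show ?thesis .
  next
    case (Root n)
    have "step X i - step Y i = ((branch X (2 * n + 1) - branch Y (2 * n + 1)) - (branch X (2 * n) - branch Y (2 * n))) / 4"
      using Root by (simp add: field_simps)
    hence "norm (step X i - step Y i) = norm ((branch X (2 * n + 1) - branch Y (2 * n + 1)) - (branch X (2 * n) - branch Y (2 * n))) / 4"
      by (simp only: norm_divide) simp
    also have "\<dots> \<le> (K / 10 + K / 10) / 4"
      using norm_triangle_ineq4[of "branch X (2 * n + 1) - branch Y (2 * n + 1)" "branch X (2 * n) - branch Y (2 * n)"]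
        dB[of "2 * n + 1"] dB[of "2 * n"] by simp
    also have "\<dots> \<le> 3/4 * K * weight i" using K Root by simp
    finally show ?thesis .
  next
    case (Crit j)
    define n where "n = j div 2"
    define q where "q X = (offset X j)\<^sup>2 * coord_tail 2 X n (X (Crit j)) / (offset X j + X (Root n))" for X
    note oX = boxed_offset[OF X, of j, folded n_def] and oY = boxed_offset[OF Y, of j, folded n_def]
    have "norm (offset X j * offset X j - offset Y j * offset Y j) \<le> (5 * K) * (101/100) + (101/100) * (5 * K)"
      by (rule norm_mult_diff_le[OF dO oX(4) oY(4) dO])
    hence sq: "norm ((offset X j)\<^sup>2 - (offset Y j)\<^sup>2) \<le> 11 * K" using K by (simp add: power2_eq_square)
    have "norm ((offset Y j)\<^sup>2) \<le> (101/100)\<^sup>2" unfolding norm_power using oY(4) by (intro power_mono) auto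
    hence sY: "norm ((offset Y j)\<^sup>2) \<le> 2" by (simp add: power2_eq_square)
    have tX: "norm (coord_tail 2 X n (X (Crit j))) \<le> 1/40000" and tY: "norm (coord_tail 2 Y n (Y (Crit j))) \<le> 1/40000"
      unfolding n_def using X Y by (simp_all only: tail_le boxed_near boxed_apart_Crit zero_less_numeral)
    have num: "norm ((offset X j)\<^sup>2 * coord_tail 2 X n (X (Crit j)) - (offset Y j)\<^sup>2 * coord_tail 2 Y n (Y (Crit j)))
        \<le> (11 * K) * (1/40000) + 2 * (K / 1000)"
      by (rule norm_mult_diff_le[OF sq tX sY tC[of 2 j, folded n_def]]) simp
    have nY: "norm ((offset Y j)\<^sup>2 * coord_tail 2 Y n (Y (Crit j))) \<le> 2 * (1/40000)"
      unfolding norm_mult by (intro mult_mono sY tY) auto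
    have den: "norm ((offset X j + X (Root n)) - (offset Y j + Y (Root n))) \<le> 6 * K"
      using dO[of j] dR[of n] by norm
    have "norm (q X - q Y) \<le> ((11 * K) * (1/40000) + 2 * (K / 1000)) / (19/10)
        + 2 * (1/40000) * (6 * K) / ((19/10) * (19/10))"
      unfolding q_def by (rule norm_divide_diff_le[OF num nY den oX(5) oY(5)]) auto
    also have "\<dots> \<le> K" using K by simp
    finally have q: "norm (sg j * (q X - q Y)) \<le> K" by (simp add: norm_mult)
    have r: "norm (sg j * (X (Root n) - Y (Root n))) \<le> K" using dR[of n] by (simp add: norm_mult)
    have "step X i - step Y i = (X (Pole n) - Y (Pole n)) + sg j * (X (Root n) - Y (Root n)) + sg j * (q X - q Y)"
      using Crit by (simp add: q_def n_def algebra_simps)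
    also have "norm \<dots> \<le> K + K + K"
      by (rule order_trans[OF norm_add3_le]) (use dP[of n] r q in linarith)
    finally show ?thesis using Crit by simp
  next
    case (Val j)
    define D where "D X = X (Val j) + coord_tail 1 X (Suc j) (X (Val j)) - X (Crit j) / 1000000" for X
    have "norm (X (Crit j) / 1000000 - Y (Crit j) / 1000000) = norm (X (Crit j) - Y (Crit j)) / 1000000"
      by (simp add: norm_divide flip: diff_divide_distrib)
    hence c: "norm (X (Crit j) / 1000000 - Y (Crit j) / 1000000) \<le> K / 1000" using dC[of j] K by simp
    have "norm (D X - D Y) \<le> 2 * K + K / 1000 + K / 1000"
      unfolding D_def by (rule norm_diff3_le(2)[OF dV tV c])
    hence dD: "norm (D X - D Y) \<le> 3 * K" using K by simp
    have DX: "norm (D X) \<ge> 1000" and DY: "norm (D Y) \<ge> 1000"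
      unfolding D_def using boxed_Val_denominator X Y by auto
    note sX = near_norm_s[OF boxed_near[OF X], of "Suc j"] and sY = near_norm_s[OF boxed_near[OF Y], of "Suc j"]
    have "norm (X (Root (Suc j)) * X (Root (Suc j)) - Y (Root (Suc j)) * Y (Root (Suc j)))
        \<le> K * (1001/1000) + (1001/1000) * K"
      by (rule norm_mult_diff_le[OF dR sX sY dR])
    hence sq: "norm ((X (Root (Suc j)))\<^sup>2 - (Y (Root (Suc j)))\<^sup>2) \<le> 3 * K" using K by (simp add: power2_eq_square)
    have "norm ((X (Root (Suc j)))\<^sup>2 / D X - (Y (Root (Suc j)))\<^sup>2 / D Y) \<le> 3 * K / 1000 + 2 * (3 * K) / (1000 * 1000)"
      by (rule norm_divide_diff_le[OF sq near_norm_s2[OF boxed_near[OF Y]] dD DX DY]) auto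
    also have "\<dots> \<le> K / 10" using K by simp
    finally have q: "norm ((X (Root (Suc j)))\<^sup>2 / D X - (Y (Root (Suc j)))\<^sup>2 / D Y) \<le> K / 10" .
    have "step X i - step Y i = (X (Pole (Suc j)) - Y (Pole (Suc j))) - ((X (Root (Suc j)))\<^sup>2 / D X - (Y (Root (Suc j)))\<^sup>2 / D Y)"
      using Val by (simp add: D_def)
    also have "norm \<dots> \<le> K + K / 10" using dP[of "Suc j"] q by norm
    finally show ?thesis using Val K by simp
  qed
qed

lemma fixed_configuration:
  obtains X where "boxed X" "step X = X"
proof (rule weighted_contraction_fixpoint[where \<Phi> = step and w = weight and M = 2 and \<theta> = "3/4"
      and B = "\<lambda>i. cball (centre i) (radius i)" and ?x0.0 = centre])
  have boxed_iff: "(\<forall>i. X i \<in> cball (centre i) (radius i)) \<longleftrightarrow> boxed X" for X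
    by (simp add: boxed_def dist_norm norm_minus_commute)
  show "centre i \<in> cball (centre i) (radius i)" for i by (cases i) auto
  show "step X i \<in> cball (centre i) (radius i)" if "\<And>i. X i \<in> cball (centre i) (radius i)" for X i
  proof -
    have "boxed X" using that boxed_iff by blast
    from boxed_step[OF this] show ?thesis by (simp add: dist_norm norm_minus_commute)
  qed
  show "norm (x - y) \<le> 2 * weight i"
    if "x \<in> cball (centre i) (radius i)" "y \<in> cball (centre i) (radius i)" for i x y
  proof -
    have "norm (x - y) \<le> radius i + radius i"
      using that dist_triangle2[of x y "centre i"] by (simp add: dist_norm norm_minus_commute)
    also have "\<dots> \<le> 2 * weight i" by (cases i) auto
    finally show ?thesis .
  qed
  show "norm (step X i - step Y i) \<le> 3/4 * K * weight i"
    if "\<And>i. X i \<in> cball (centre i) (radius i)" "\<And>i. Y i \<in> cball (centre i) (radius i)" "0 \<le> K"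
      "\<And>i. norm (X i - Y i) \<le> K * weight i" for X Y K i
    using step_contraction[of X Y K i] that boxed_iff by blast
  show thesis if "\<And>i. X i \<in> cball (centre i) (radius i)" "step X = X" for X
    using \<open>\<And>X. boxed X \<Longrightarrow> step X = X \<Longrightarrow> thesis\<close> that boxed_iff by blast
qed auto

subsection \<open>The function of a configuration\<close>

text \<open>With the pole nearby split off, the equations say f'(c j) = 0, f (c j) = v j and f (v j)
  = c j, before \<open>f\<close> is available. \<open>v_neq\<close> ensures that the last one is not
  an artefact of division by zero.\<close>

locale configuration =
  fixes p s c v :: "nat \<Rightarrow> complex"
  assumes near: "near p s"
    and c_near: "\<And>j. norm (c j - (base (j div 2) + sg j)) \<le> 4/1000"
    and v_near: "\<And>j. norm (v j - base (Suc j)) \<le> 1"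
    and critical: "\<And>j. (c j - p (j div 2))\<^sup>2 * (1 - tail 2 p s (j div 2) (c j)) = (s (j div 2))\<^sup>2"
    and crit_value: "\<And>j. v j = 1000000 * (c j + (s (j div 2))\<^sup>2 / (c j - p (j div 2)) + tail 1 p s (j div 2) (c j))"
    and v_neq: "\<And>j. v j \<noteq> p (Suc j)"
    and value_returns: "\<And>j. c j = 1000000 * (v j + (s (Suc j))\<^sup>2 / (v j - p (Suc j)) + tail 1 p s (Suc j) (v j))"

lemma configuration_exists: "\<exists>p s c v. configuration p s c v"
proof -
  obtain X where X: "boxed X" "step X = X" by (rule fixed_configuration)
  define p s c v where defs: "p n = X (Pole n)" "s n = X (Root n)" "c n = X (Crit n)" "v n = X (Val n)" for n
  have lam: "(\<lambda>n. X (Pole n)) = p" "(\<lambda>n. X (Root n)) = s" by (auto simp: defs)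
  define t where "t = offset X"
  have c: "c j = p (j div 2) + sg j * t j" for j by (simp add: t_def offset_def defs)
  have t0: "t j \<noteq> 0" "t j + s (j div 2) \<noteq> 0" for j
    using boxed_offset(3,5)[OF X(1), of j] by (auto simp: t_def defs)
  have s0: "s n \<noteq> 0" for n using boxedD(2)[OF X(1), of n] by (auto simp: defs)
  have "configuration p s c v"
  proof
    show "near p s" using boxed_near[OF X(1)] by (simp add: lam)
    show "norm (c j - (base (j div 2) + sg j)) \<le> 4/1000" "norm (v j - base (Suc j)) \<le> 1" for j
      using boxedD(3,4)[OF X(1)] by (simp_all add: defs)
    show "(c j - p (j div 2))\<^sup>2 * (1 - tail 2 p s (j div 2) (c j)) = (s (j div 2))\<^sup>2" for j
    proof -
      define n where "n = j div 2"
      define e where "e = tail 2 p s n (c j)"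
      have "c j = p n + sg j * s n + sg j * ((t j)\<^sup>2 * e / (t j + s n))"
        using X(2)[THEN fun_cong, of "Crit j"] by (simp add: lam defs(3) t_def e_def n_def) (simp add: defs)
      hence "sg j * t j = sg j * (s n + (t j)\<^sup>2 * e / (t j + s n))"
        using c[of j, folded n_def] by (simp add: algebra_simps)
      hence "t j = s n + (t j)\<^sup>2 * e / (t j + s n)" by (simp add: sg_def split: if_splits)
      hence "(t j - s n) * (t j + s n) = (t j)\<^sup>2 * e"
        using t0[of j, folded n_def] by (metis add_diff_cancel_left' nonzero_eq_divide_eq)
      moreover have "(c j - p n)\<^sup>2 = (t j)\<^sup>2" using c[of j, folded n_def] by (simp add: sg_def)
      ultimately show ?thesis
        unfolding n_def[symmetric] e_def[symmetric] by (simp add: power2_eq_square algebra_simps)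
    qed
    show "v j = 1000000 * (c j + (s (j div 2))\<^sup>2 / (c j - p (j div 2)) + tail 1 p s (j div 2) (c j))" for j
    proof -
      define n where "n = j div 2"
      have "p n = (branch X (2 * n + 1) + branch X (2 * n)) / 2" "s n = (branch X (2 * n + 1) - branch X (2 * n)) / 4"
        using X(2)[THEN fun_cong, of "Pole n"] X(2)[THEN fun_cong, of "Root n"] by (simp_all add: defs)
      hence "branch X (2 * n) = p n - 2 * s n" "branch X (2 * n + 1) = p n + 2 * s n"
        by (simp_all only:) (simp_all add: field_simps)
      moreover have "j = (if even j then 2 * n else 2 * n + 1)" by (simp add: n_def)
      ultimately have "branch X j = p n + 2 * sg j * s n" by (auto simp: sg_def split: if_splits)
      hence "v j / 1000000 - tail 1 p s n (c j) - sg j * ((t j - s n)\<^sup>2 / t j) = p n + 2 * sg j * s n"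
        unfolding branch_def lam t_def[symmetric] n_def[symmetric] by (simp add: defs)
      hence "v j / 1000000 = p n + sg j * (2 * s n + (t j - s n)\<^sup>2 / t j) + tail 1 p s n (c j)"
        by (simp add: algebra_simps)
      also have "2 * s n + (t j - s n)\<^sup>2 / t j = t j + (s n)\<^sup>2 / t j"
        using t0(1)[of j] by (simp add: field_simps power2_eq_square)
      also have "sg j * (t j + (s n)\<^sup>2 / t j) = sg j * t j + (s n)\<^sup>2 / (sg j * t j)"
        by (auto simp: sg_def)
      also have "sg j * t j = c j - p n" using c[of j] by (simp add: n_def)
      finally show ?thesis by (simp add: n_def field_simps)
    qed
    fix j
    define D where "D = v j + tail 1 p s (Suc j) (v j) - c j / 1000000"
    have "norm D \<ge> 1000"
      using boxed_Val_denominator[OF X(1), of j] unfolding D_def lam defs(3,4) .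
    hence D: "D \<noteq> 0" by auto
    have "p (Suc j) - (s (Suc j))\<^sup>2 / D = v j"
      using X(2)[THEN fun_cong, of "Val j"] by (simp add: D_def flip: defs)
    from this[symmetric] have v: "v j - p (Suc j) = - ((s (Suc j))\<^sup>2 / D)" by simp
    show "v j \<noteq> p (Suc j)" using v D s0[of "Suc j"] by auto
    have "(s (Suc j))\<^sup>2 / (v j - p (Suc j)) = - D" unfolding v using D s0[of "Suc j"] by (simp add: field_simps)
    thus "c j = 1000000 * (v j + (s (Suc j))\<^sup>2 / (v j - p (Suc j)) + tail 1 p s (Suc j) (v j))"
      by (simp add: D_def)
  qed
  thus ?thesis by blast
qed

context configuration
begin

section \<open>Separation of the actual poles\<close>

lemma p_near: "norm (p n - base n) \<le> 1/1000" and s_near: "norm (s n - 1) \<le> 1/1000"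
  using near by (auto simp: near_def)

lemma s_nz: "s n \<noteq> 0" using s_near[of n] by auto

lemma p_separated: "norm (p n - p m) \<ge> 1000000 * (real m - real n)\<^sup>2"
proof (cases "m = n")
  case False
  have "norm (base n - base m) \<le> norm (p n - p m) + norm (p n - base n) + norm (p m - base m)" by norm
  thus ?thesis
    using base_separated[of m n] p_near[of n] p_near[of m] square_distance_ge_1[OF False] by linarith
qed simp

lemma p_separated_1: "m \<noteq> n \<Longrightarrow> norm (p n - p m) \<ge> 1000000"
  using p_separated[of m n] square_distance_ge_1[of m n] by linarith

lemma p_inj: "inj p"
  using p_separated_1 by (fastforce intro: injI)

lemma norm_p_ge: "norm (p n) \<ge> real n + 1" and Re_p_ge: "Re (p n) \<ge> 1000"
proof -
  have "real n + 1 \<le> (real n + 1)\<^sup>2" by (intro self_le_power) auto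
  hence b: "Re (base n) \<ge> 2000000 * (real n + 1)"
    by (intro order_trans[OF mult_left_mono Re_base_ge]) auto
  have d: "Re (base n) - Re (p n) \<le> norm (p n - base n)"
    using abs_Re_le_cmod[of "p n - base n"] by simp
  hence r: "Re (p n) \<ge> real n + 1" using b p_near[of n] by simp
  thus "norm (p n) \<ge> real n + 1" using complex_Re_le_cmod[of "p n"] by linarith
  show "Re (p n) \<ge> 1000" using b d p_near[of n] by simp
qed

text \<open>Take for \<open>n\<close> the index of a pole closest to \<open>z\<close>.\<close>

lemma apart_exists: "\<exists>n. apart p n z"
proof -
  \<comment> \<open>Poles with index above \<open>N\<close> are farther from \<open>z\<close> than
    \<open>p 0\<close>, so a minimum over finitely many indices is a global one.\<close>
  obtain N :: nat where N: "real N > norm z + norm (z - p 0)" using reals_Archimedean2 by blast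
  define n where "n = arg_min_on (\<lambda>m. norm (z - p m)) {..N}"
  have n: "norm (z - p n) \<le> norm (z - p m)" if "m \<le> N" for m
    unfolding n_def using that by (intro arg_min_least) auto
  have n': "norm (z - p n) \<le> norm (z - p m)" for m
  proof (cases "m \<le> N")
    case False
    have "norm (p m) \<le> norm (z - p m) + norm z" by norm
    hence "norm (z - p 0) \<le> norm (z - p m)" using N norm_p_ge[of m] False by linarith
    thus ?thesis using n[of 0] by simp
  qed (use n in auto)
  have "apart p n z" unfolding apart_def
  proof
    fix m
    have "norm (p n - p m) \<le> norm (z - p n) + norm (z - p m)" by norm
    thus "500000 * (real m - real n)\<^sup>2 \<le> norm (z - p m)" using n'[of m] p_separated[of m n] by linarith
  qed
  thus ?thesis ..
qed

lemma apart_near: "norm (x - p n) \<le> 1 \<Longrightarrow> apart p n x"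
proof -
  assume "norm (x - p n) \<le> 1"
  moreover have "norm (x - base n) \<le> norm (x - p n) + norm (p n - base n)" by norm
  ultimately have "norm (x - base n) \<le> 2" using p_near[of n] by linarith
  thus ?thesis by (rule apartI[OF near])
qed

lemma terms_summable: "summable (\<lambda>m. (s m)\<^sup>2 / (z - p m))"
proof -
  obtain n where n: "apart p n z" using apart_exists by blast
  have "summable (\<lambda>m. if m = n then 0 else (s m)\<^sup>2 / (z - p m) ^ 1)" by (rule tail_summable[OF near n]) auto
  moreover have "\<forall>\<^sub>F m in sequentially. (if m = n then 0 else (s m)\<^sup>2 / (z - p m) ^ 1) = (s m)\<^sup>2 / (z - p m)"
    using eventually_gt_at_top[of n] by eventually_elim auto
  ultimately show ?thesis using summable_cong by fast
qed

text \<open>The value 0 at the poles is the one prescribed by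
  \<open>nicely_meromorphic_on\<close>.\<close>

definition f :: "complex \<Rightarrow> complex" where
  "f z = (if z \<in> range p then 0 else 1000000 * (z + (\<Sum>m. (s m)\<^sup>2 / (z - p m))))"

lemma suminf_split: "(\<Sum>m. (s m)\<^sup>2 / (z - p m)) = (s n)\<^sup>2 / (z - p n) + tail 1 p s n z"
proof -
  let ?g = "\<lambda>m. (s m)\<^sup>2 / (z - p m)"
  have a: "(\<lambda>m. if m = n then ?g n else 0) sums ?g n" using sums_single[of n "\<lambda>_. ?g n"] by simp
  have "(\<lambda>m. ?g m - (if m = n then ?g n else 0)) sums (suminf ?g - ?g n)"
    by (intro sums_diff a summable_sums terms_summable)
  also have "(\<lambda>m. ?g m - (if m = n then ?g n else 0)) = (\<lambda>m. if m = n then 0 else (s m)\<^sup>2 / (z - p m) ^ 1)"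
    by auto
  finally have "tail 1 p s n z = suminf ?g - ?g n" unfolding tail_def by (rule sums_unique[symmetric])
  thus ?thesis by simp
qed

lemma f_eq: "z \<notin> range p \<Longrightarrow> f z = 1000000 * (z + (s n)\<^sup>2 / (z - p n) + tail 1 p s n z)"
  by (simp add: f_def suminf_split[of z n] add.assoc)

lemma not_pole_point: "apart p n z \<Longrightarrow> z \<noteq> p n \<Longrightarrow> z \<notin> range p"
  using apart_ge(2)[of p n z] by fastforce

lemma ball_avoids_poles:
  assumes "apart p n z" "w \<noteq> p n" "norm (w - z) < 1"
  shows "w \<notin> range p"
proof
  assume "w \<in> range p"
  then obtain m where m: "w = p m" by auto
  with assms have "m \<noteq> n" by auto
  from apart_ge(1)[OF assms(1) this] square_distance_ge_1[OF this] m assms(3)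
  show False by (simp add: norm_minus_commute)
qed

lemma closed_poles: "closed (range p)"
  unfolding closed_def open_contains_ball
proof safe
  fix z assume z: "z \<notin> range p"
  obtain n where n: "apart p n z" using apart_exists by blast
  have "ball z (min 1 (norm (z - p n))) \<subseteq> - range p"
  proof
    fix w assume "w \<in> ball z (min 1 (norm (z - p n)))"
    hence "w \<noteq> p n" "norm (w - z) < 1" by (auto simp: dist_norm norm_minus_commute)
    thus "w \<in> - range p" using ball_avoids_poles[OF n] by blast
  qed
  moreover have "min 1 (norm (z - p n)) > 0" using z by auto
  ultimately show "\<exists>e>0. ball z e \<subseteq> - range p" by blast
qed

text \<open>Termwise differentiation: within the unit ball about \<open>z\<close> the separation
  constant drops only from 500000 to 400000, so the derived series stays dominated by inverse
  squares.\<close>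

lemma tail_has_derivative:
  assumes "apart p n z"
  shows "(tail 1 p s n has_field_derivative - tail 2 p s n z) (at z)"
proof -
  let ?f = "\<lambda>m x. if m = n then 0 else (s m)\<^sup>2 / (x - p m) ^ 1"
  let ?f' = "\<lambda>m x. if m = n then 0 else - ((s m)\<^sup>2 / (x - p m) ^ 2)"
  have ge: "norm (x - p m) \<ge> 400000 * (real m - real n)\<^sup>2" "norm (x - p m) \<ge> 1"
    if "x \<in> ball z 1" "m \<noteq> n" for x m
  proof -
    have "norm (z - p m) \<le> norm (x - p m) + norm (z - x)" by norm
    moreover have "norm (z - x) < 1" using that by (simp add: dist_norm)
    ultimately show "norm (x - p m) \<ge> 400000 * (real m - real n)\<^sup>2" "norm (x - p m) \<ge> 1"
      using apart_ge(1)[OF assms that(2)] square_distance_ge_1[OF that(2)] by linarith+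
  qed
  have bnd: "norm (?f' m x) \<le> 2 * (1 / (real m - real n)\<^sup>2)" if "x \<in> ball z 1" for m x
  proof (cases "m = n")
    case False
    note g = ge[OF that False] and d = square_distance_ge_1[OF False]
    have "norm (x - p m) \<ge> (real m - real n)\<^sup>2" using g d by linarith
    moreover have "norm (x - p m) ^ 2 \<ge> norm (x - p m)" using g(2) by (intro self_le_power) auto
    ultimately have "norm ((s m)\<^sup>2) / norm (x - p m) ^ 2 \<le> 2 / (real m - real n)\<^sup>2"
      using d near_norm_s2[OF near, of m] by (intro frac_le) auto
    thus ?thesis using False by (simp add: norm_divide norm_power)
  qed simp
  have "uniformly_convergent_on (ball z 1) (\<lambda>k x. \<Sum>i<k. ?f' i x)"
    by (rule Weierstrass_m_test'_ev[OF always_eventually summable_mult[OF inverse_square_distances(1)]])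
      (use bnd in blast)
  moreover have "(?f m has_field_derivative ?f' m x) (at x within ball z 1)" if "x \<in> ball z 1" for m x
  proof (cases "m = n")
    case False
    have "x - p m \<noteq> 0" using ge(2)[OF that False] by auto
    hence "((\<lambda>x. (s m)\<^sup>2 / (x - p m)) has_field_derivative - ((s m)\<^sup>2 / (x - p m) ^ 2)) (at x within ball z 1)"
      by (auto intro!: derivative_eq_intros simp: power2_eq_square)
    thus ?thesis using False by simp
  qed simp
  ultimately have "((\<lambda>x. \<Sum>m. ?f m x) has_field_derivative (\<Sum>m. ?f' m z)) (at z)"
    by (intro has_field_derivative_series'(2)[where S = "ball z 1" and ?x0.0 = z])
      (use tail_summable[OF near assms, of 1] in auto)
  moreover have "(\<Sum>m. ?f' m z) = - tail 2 p s n z"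
  proof -
    have "(\<Sum>m. - (if m = n then 0 else (s m)\<^sup>2 / (z - p m) ^ 2)) = - tail 2 p s n z"
      unfolding tail_def by (rule suminf_minus) (rule tail_summable[OF near assms], simp)
    moreover have "?f' m z = - (if m = n then 0 else (s m)\<^sup>2 / (z - p m) ^ 2)" for m by simp
    ultimately show ?thesis by (simp only:)
  qed
  ultimately show ?thesis by (simp only: tail_def[abs_def])
qed

lemma f_has_derivative:
  assumes "apart p n z" "z \<noteq> p n"
  shows "(f has_field_derivative 1000000 * (1 - (s n)\<^sup>2 / (z - p n)\<^sup>2 - tail 2 p s n z)) (at z)"
proof -
  have "((\<lambda>z. 1000000 * (z + (s n)\<^sup>2 / (z - p n) + tail 1 p s n z)) has_field_derivative
      1000000 * (1 - (s n)\<^sup>2 / (z - p n)\<^sup>2 - tail 2 p s n z)) (at z)"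
    by (rule derivative_eq_intros tail_has_derivative[OF assms(1)] refl | use assms(2) in \<open>simp add: power2_eq_square\<close>)+
  moreover have "open (- range p)" "z \<in> - range p" using closed_poles not_pole_point[OF assms] by auto
  ultimately show ?thesis
    by (rule has_field_derivative_transform_within_open) (use f_eq[of _ n] in auto)
qed

lemma f_holomorphic: "f holomorphic_on (- range p)"
  unfolding holomorphic_on_open[OF closed_poles[unfolded closed_def]]
proof
  fix z assume "z \<in> - range p"
  moreover obtain n where "apart p n z" using apart_exists by blast
  ultimately show "\<exists>f'. (f has_field_derivative f') (at z)"
    using f_has_derivative[of n z] by auto
qed

text \<open>Multiplication by \<open>w - p n\<close> cancels the one singular summand and leaves a
  function continuous at \<open>p n\<close> with the nonzero value 10^6 times
  \<open>(s n)\<^sup>2\<close>.\<close>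

lemma is_pole_f: "is_pole f (p n)"
proof -
  define F where "F w = 1000000 * ((w + tail 1 p s n w) * (w - p n) + (s n)\<^sup>2)" for w
  have ap: "apart p n (p n)" by (rule apart_near) simp
  have "isCont (tail 1 p s n) (p n)" by (rule DERIV_isCont[OF tail_has_derivative[OF ap]])
  hence "isCont F (p n)" unfolding F_def by (intro continuous_intros)
  moreover have "filterlim (\<lambda>w. w - p n) (at 0) (at (p n))"
    by (rule filterlim_atI) (auto intro!: tendsto_eq_intros simp: eventually_at_filter)
  moreover have "F (p n) \<noteq> 0" using s_nz by (simp add: F_def)
  ultimately have "is_pole (\<lambda>w. F w / (w - p n)) (p n)" by (rule is_pole_divide)
  moreover have "\<forall>\<^sub>F w in at (p n). F w / (w - p n) = f w"
    unfolding eventually_at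
  proof (intro exI[of _ 1] conjI ballI impI)
    fix w assume w: "w \<noteq> p n \<and> dist w (p n) < 1"
    hence "w \<notin> range p" by (intro ball_avoids_poles[OF ap]) (auto simp: dist_norm)
    from f_eq[OF this, of n] w show "F w / (w - p n) = f w"
      by (simp add: F_def field_simps)
  qed auto
  ultimately show ?thesis using is_pole_transform by blast
qed

lemma is_pole_f_iff: "is_pole f z \<longleftrightarrow> z \<in> range p"
  using is_pole_f not_is_pole_holomorphic[of "- range p" z f] closed_poles f_holomorphic by auto

lemma f_nicely_meromorphic: "f nicely_meromorphic_on UNIV"
  unfolding nicely_meromorphic_on_def meromorphic_on_altdef
proof (intro conjI ballI)
  fix z
  have iso: "isolated_singularity_at f z"
  proof -
    obtain n where n: "apart p n z" using apart_exists by blast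
    define r where "r = (if z = p n then 1 else min 1 (norm (z - p n)))"
    have "r > 0" by (simp add: r_def)
    moreover have "ball z r - {z} \<subseteq> - range p"
    proof
      fix w assume w: "w \<in> ball z r - {z}"
      hence "w \<noteq> p n" "norm (w - z) < 1" by (auto simp: r_def dist_norm norm_minus_commute split: if_splits)
      thus "w \<in> - range p" using ball_avoids_poles[OF n] by blast
    qed
    hence "f analytic_on ball z r - {z}"
      by (subst analytic_on_open) (auto intro: holomorphic_on_subset[OF f_holomorphic])
    ultimately show ?thesis unfolding isolated_singularity_at_def by blast
  qed
  have *: "(is_pole f z \<and> f z = 0) \<or> f \<midarrow>z\<rightarrow> f z"
  proof (cases "z \<in> range p")
    case False
    hence "isCont f z"
      using f_holomorphic closed_poles continuous_on_eq_continuous_at holomorphic_on_imp_continuous_on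
      by (metis ComplI open_Compl)
    thus ?thesis by (simp add: isCont_def)
  qed (simp add: is_pole_f_iff f_def)
  show "(is_pole f z \<and> f z = 0) \<or> f \<midarrow>z\<rightarrow> f z" by (rule *)
  show "isolated_singularity_at f z" by (rule iso)
  show "not_essential f z" using * by auto
qed

text \<open>Every pole would be a root of the denominator, but there are infinitely many
  poles.\<close>

lemma f_transcendental: "transcendental_meromorphic f"
  unfolding transcendental_meromorphic_def
proof (intro conjI f_nicely_meromorphic notI)
  assume "\<exists>P Q :: complex poly. Q \<noteq> 0 \<and> (\<forall>z. poly Q z \<noteq> 0 \<longrightarrow> f z = poly P z / poly Q z)"
  then obtain P Q :: "complex poly" where Q: "Q \<noteq> 0" and PQ: "\<And>z. poly Q z \<noteq> 0 \<Longrightarrow> f z = poly P z / poly Q z"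
    by blast
  have "range p \<subseteq> {z. poly Q z = 0}"
  proof safe
    fix n
    show "poly Q (p n) = 0"
    proof (rule ccontr)
      assume nz: "poly Q (p n) \<noteq> 0"
      have "\<not> is_pole f (p n)"
      proof (rule not_is_pole_holomorphic)
        show "open {z. poly Q z \<noteq> 0}" by (intro open_Collect_neq continuous_intros)
        have "(\<lambda>z. poly P z / poly Q z) holomorphic_on {z. poly Q z \<noteq> 0}"
          by (intro holomorphic_intros) auto
        thus "f holomorphic_on {z. poly Q z \<noteq> 0}"
          by (rule holomorphic_transform) (use PQ in auto)
      qed (use nz in auto)
      thus False using is_pole_f by blast
    qed
  qed
  hence "finite (range p)" using poly_roots_finite[OF Q] finite_subset by blast
  thus False using p_inj finite_imageD infinite_UNIV_nat by blast
qed

end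

subsection \<open>Fatou components on which the iterates escape\<close>

lemma norm_to_sphere: "norm (to_sphere z) = 1"
proof -
  have "norm z ^ 2 + 1 > 0" by (simp add: add_nonneg_pos)
  have "(2 / (norm z ^ 2 + 1) * norm z) ^ 2 + ((norm z ^ 2 - 1) / (norm z ^ 2 + 1)) ^ 2
      = ((2 * norm z) ^ 2 + (norm z ^ 2 - 1) ^ 2) / (norm z ^ 2 + 1) ^ 2"
    by (simp add: power_divide add_divide_distrib)
  also have "(2 * norm z) ^ 2 + (norm z ^ 2 - 1) ^ 2 = (norm z ^ 2 + 1) ^ 2" by algebra
  also have "\<dots> / (norm z ^ 2 + 1) ^ 2 = 1" using \<open>norm z ^ 2 + 1 > 0\<close> by simp
  finally have "(2 / (norm z ^ 2 + 1) * norm z) ^ 2 + ((norm z ^ 2 - 1) / (norm z ^ 2 + 1)) ^ 2 = 1" .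
  thus ?thesis by (simp add: to_sphere_def norm_Pair power_divide)
qed

text \<open>The reciprocal is a continuous function of the spherical point away from the south pole;
  chordal convergence near infinity thus becomes ordinary convergence of reciprocals. At z = 0 both
  sides are 0 by convention.\<close>

lemma inverse_to_sphere: "inverse z = cnj (fst (to_sphere z)) / of_real (1 + snd (to_sphere z))"
proof (cases "z = 0")
  case False
  have p: "norm z ^ 2 + 1 > 0" by (simp add: add_nonneg_pos)
  have "1 + snd (to_sphere z) = (2 / (norm z ^ 2 + 1)) * norm z ^ 2"
    using p by (simp add: to_sphere_def field_simps)
  hence "of_real (1 + snd (to_sphere z)) = of_real (2 / (norm z ^ 2 + 1)) * (z * cnj z)"
    by (simp only: of_real_mult complex_norm_square)
  moreover have "cnj (fst (to_sphere z)) = of_real (2 / (norm z ^ 2 + 1)) * cnj z"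
    by (simp add: to_sphere_def scaleR_conv_of_real)
  moreover have "of_real (2 / (norm z ^ 2 + 1)) \<noteq> (0 :: complex)" using p by (simp only: of_real_eq_0_iff) simp
  ultimately show ?thesis using False by (simp add: field_simps del: of_real_divide of_real_add)
qed (simp add: to_sphere_def)

lemma dist_to_sphere_infinity_le:
  assumes "norm z \<ge> 1"
  shows "dist (to_sphere z) (0, 1) \<le> 4 / norm z"
proof -
  have p: "norm z ^ 2 + 1 > 0" by (simp add: add_nonneg_pos)
  have "to_sphere z - (0, 1) = ((2 / ((norm z)\<^sup>2 + 1)) *\<^sub>R z, - 2 / (norm z ^ 2 + 1))"
    using p by (simp add: to_sphere_def field_simps)
  hence "dist (to_sphere z) (0, 1) \<le> norm ((2 / ((norm z)\<^sup>2 + 1)) *\<^sub>R z) + norm (- 2 / (norm z ^ 2 + 1))"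
    by (simp only: dist_norm norm_Pair_le)
  also have "\<dots> = (2 * norm z + 2) / (norm z ^ 2 + 1)" using p by (simp add: add_divide_distrib)
  also have "\<dots> \<le> (4 * norm z) / norm z ^ 2" using assms by (intro frac_le) auto
  also have "\<dots> = 4 / norm z" by (simp add: power2_eq_square)
  finally show ?thesis .
qed

lemma continuous_to_sphere: "continuous_on S to_sphere"
proof -
  have "norm (x :: complex) ^ 2 + 1 \<noteq> 0" for x by (smt (verit) zero_le_power2)
  thus ?thesis unfolding to_sphere_def by (intro continuous_intros) auto
qed

lemma to_sphere_tendsto_infinity_iff:
  "((\<lambda>n. to_sphere (s n)) \<longlongrightarrow> (0, 1)) F \<longleftrightarrow> filterlim s at_infinity F"
proof
  assume s: "filterlim s at_infinity F"
  have "((\<lambda>n. dist (to_sphere (s n)) (0, 1)) \<longlongrightarrow> 0) F"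
  proof (rule tendsto_sandwich[OF _ _ tendsto_const])
    show "((\<lambda>n. 4 / norm (s n)) \<longlongrightarrow> 0) F"
      by (intro real_tendsto_divide_at_top[OF tendsto_const] filterlim_compose[OF filterlim_norm_at_top s])
    show "\<forall>\<^sub>F n in F. dist (to_sphere (s n)) (0, 1) \<le> 4 / norm (s n)"
      using s[unfolded filterlim_at_infinity[OF order.refl], rule_format, of 1]
      by (auto elim!: eventually_mono intro: dist_to_sphere_infinity_le)
  qed auto
  thus "((\<lambda>n. to_sphere (s n)) \<longlongrightarrow> (0, 1)) F" using tendsto_dist_iff by blast
next
  assume s: "((\<lambda>n. to_sphere (s n)) \<longlongrightarrow> (0, 1)) F"
  have "((\<lambda>n. inverse (s n)) \<longlongrightarrow> cnj (fst (0 :: complex, 1 :: real)) / of_real (1 + snd (0 :: complex, 1 :: real))) F"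
    unfolding inverse_to_sphere by (intro tendsto_intros s) auto
  hence inv: "((\<lambda>n. inverse (s n)) \<longlongrightarrow> 0) F" by simp
  \<comment> \<open>This excludes the value 0, whose reciprocal is 0 as well and would imitate
    infinity.\<close>
  have "((\<lambda>n. snd (to_sphere (s n))) \<longlongrightarrow> snd (0 :: complex, 1 :: real)) F" by (intro tendsto_intros s)
  hence "\<forall>\<^sub>F n in F. snd (to_sphere (s n)) > 0" by (rule order_tendstoD) simp
  hence "\<forall>\<^sub>F n in F. inverse (s n) \<noteq> 0" by eventually_elim (auto simp: to_sphere_def)
  with inv have "filterlim (\<lambda>n. inverse (s n)) (at 0) F" by (simp add: filterlim_at)
  from filterlim_compose[OF filterlim_inverse_at_infinity this] show "filterlim s at_infinity F" by simp
qed

text \<open>Near a point where the spherical limit is infinite the reciprocals converge to a holomorphic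
  function with a zero; being nonvanishing, they can do so only if the limit vanishes identically.\<close>

lemma spherical_limit_infinity_near:
  assumes V: "open V" and hol: "\<And>n. s n holomorphic_on V"
    and lim: "\<And>K. compact K \<Longrightarrow> K \<subseteq> V \<Longrightarrow> uniform_limit K (\<lambda>n z. to_sphere (s n z)) g sequentially"
    and z0: "z0 \<in> V" "g z0 = (0, 1)"
  shows "\<exists>e>0. \<forall>z\<in>ball z0 e. g z = (0, 1)"
proof -
  obtain r where r: "r > 0" "cball z0 r \<subseteq> V" using V z0 open_contains_cball by blast
  have "continuous_on (cball z0 r) g"
  proof (rule uniform_limit_theorem[OF _ lim[OF compact_cball r(2)]])
    show "\<forall>\<^sub>F n in sequentially. continuous_on (cball z0 r) (\<lambda>z. to_sphere (s n z))"
      using hol r(2) by (intro always_eventually allI continuous_on_compose2[OF continuous_to_sphere[of UNIV]])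
        (auto intro: holomorphic_on_imp_continuous_on holomorphic_on_subset)
  qed simp
  hence "continuous_on (cball z0 r) (\<lambda>z. snd (g z))" by (intro continuous_intros)
  from this[unfolded continuous_on_iff, rule_format, of z0 "1/2"]
  obtain d where d: "d > 0" "\<And>z. z \<in> cball z0 r \<Longrightarrow> dist z z0 < d \<Longrightarrow> dist (snd (g z)) 1 < 1/2"
    using r(1) z0(2) by auto
  define e where "e = min r (d / 2)"
  have e: "e > 0" "cball z0 e \<subseteq> cball z0 r" using r d by (auto simp: e_def)
  have g: "snd (g z) > 1/2" if "z \<in> cball z0 e" for z
  proof -
    have "z \<in> cball z0 r" "dist z z0 < d" using that e(2) d(1) by (auto simp: e_def dist_commute)
    from d(2)[OF this] show ?thesis unfolding dist_real_def by linarith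
  qed
  have ul: "uniform_limit (cball z0 e) (\<lambda>n z. to_sphere (s n z)) g sequentially"
    using e(2) r(2) by (intro lim) auto
  \<comment> \<open>The height of the limit exceeds 1/2 here, so an error below 1/2 keeps
    \<open>s n z\<close> away from 0, whose height is -1.\<close>
  have "\<forall>\<^sub>F n in sequentially. \<forall>z\<in>cball z0 e. dist (to_sphere (s n z)) (g z) < 1/2"
    using ul by (rule uniform_limitD) simp
  then obtain M where M: "\<And>n z. n \<ge> M \<Longrightarrow> z \<in> cball z0 e \<Longrightarrow> dist (to_sphere (s n z)) (g z) < 1/2"
    unfolding eventually_sequentially by blast
  have nz: "s n z \<noteq> 0" if "n \<ge> M" "z \<in> cball z0 e" for n z
  proof
    assume "s n z = 0"
    hence "snd (to_sphere (s n z)) = -1" by (simp add: to_sphere_def)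
    moreover have "dist (snd (to_sphere (s n z))) (snd (g z)) < 1/2"
      using M[OF that] dist_snd_le by (rule le_less_trans[rotated])
    ultimately show False using g[OF that(2)] by (simp add: dist_real_def)
  qed
  define h where "h z = cnj (fst (g z)) / of_real (1 + snd (g z))" for z
  have ulh: "uniform_limit (cball z0 e) (\<lambda>n z. inverse (s n z)) h sequentially"
    unfolding inverse_to_sphere h_def
  proof (rule uniform_lim_divide[where b = 1])
    show "uniform_limit (cball z0 e) (\<lambda>n z. cnj (fst (to_sphere (s n z)))) (\<lambda>z. cnj (fst (g z))) sequentially"
      by (intro bounded_linear.uniform_limit[OF bounded_linear_cnj] bounded_linear.uniform_limit[OF bounded_linear_fst] ul)
    show "uniform_limit (cball z0 e) (\<lambda>n z. complex_of_real (1 + snd (to_sphere (s n z))))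
        (\<lambda>z. complex_of_real (1 + snd (g z))) sequentially"
      by (intro bounded_linear.uniform_limit[OF bounded_linear_of_real] uniform_limit_intros
          bounded_linear.uniform_limit[OF bounded_linear_snd] ul)
    have "continuous_on (cball z0 e) g" using \<open>continuous_on (cball z0 r) g\<close> e(2) continuous_on_subset by blast
    hence "compact ((\<lambda>z. cnj (fst (g z))) ` cball z0 e)"
      by (intro compact_continuous_image continuous_intros) auto
    thus "bounded ((\<lambda>z. cnj (fst (g z))) ` cball z0 e)" by (rule compact_imp_bounded)
    show "1 \<le> norm (complex_of_real (1 + snd (g z)))" if "z \<in> cball z0 e" for z
      using g[OF that] by (simp only: norm_of_real)
  qed auto
  have F_hol: "(\<lambda>z. inverse (s (n + M) z)) holomorphic_on ball z0 e" for n
  proof (rule holomorphic_on_inverse)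
    have "ball z0 e \<subseteq> V" using e(2) r(2) ball_subset_cball by blast
    with hol show "s (n + M) holomorphic_on ball z0 e" by (rule holomorphic_on_subset)
    show "s (n + M) z \<noteq> 0" if "z \<in> ball z0 e" for z using nz[of "n + M" z] that by simp
  qed
  have F_lim: "uniform_limit K (\<lambda>n z. inverse (s (n + M) z)) h sequentially" if "K \<subseteq> ball z0 e" for K
    by (rule filterlim_compose[OF uniform_limit_on_subset[OF ulh] filterlim_add_const_nat_at_top])
      (use that in auto)
  have h_hol: "h holomorphic_on ball z0 e"
  proof (rule holomorphic_uniform_sequence[OF open_ball F_hol])
    fix x assume "x \<in> ball z0 e"
    then obtain d where "d > 0" "cball x d \<subseteq> ball z0 e" using open_ball open_contains_cball by blast
    thus "\<exists>d>0. cball x d \<subseteq> ball z0 e \<and> uniform_limit (cball x d) (\<lambda>n z. inverse (s (n + M) z)) h sequentially"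
      using F_lim by blast
  qed
  have "h constant_on ball z0 e"
  proof (rule ccontr)
    assume nc: "\<not> h constant_on ball z0 e"
    have "h z0 \<noteq> 0"
    proof (rule Hurwitz_no_zeros[OF open_ball connected_ball F_hol h_hol F_lim nc])
      show "inverse (s (n + M) z) \<noteq> 0" if "z \<in> ball z0 e" for n z using nz[of "n + M" z] that by simp
    qed (use e(1) in auto)
    thus False by (simp add: h_def z0(2))
  qed
  then obtain k where k: "h z = k" if "z \<in> ball z0 e" for z unfolding constant_on_def by blast
  have "k = 0" using k[of z0] e(1) z0(2) by (simp add: h_def)
  hence h0: "h z = 0" if "z \<in> ball z0 e" for z using k[OF that] by simp
  have "g z = (0, 1)" if z: "z \<in> ball z0 e" for z
  proof -
    have zc: "z \<in> cball z0 e" using z by simp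
    \<comment> \<open>The limit lies on the unit sphere and its first component vanishes, so it is
      one of the two poles of the sphere; positive height selects infinity.\<close>
    have "(\<lambda>n. to_sphere (s n z)) \<longlonglongrightarrow> g z" by (rule tendsto_uniform_limitI[OF ul zc])
    hence "(\<lambda>n. norm (to_sphere (s n z))) \<longlonglongrightarrow> norm (g z)" by (rule tendsto_norm)
    hence "norm (g z) = 1" unfolding norm_to_sphere by (simp add: LIMSEQ_const_iff)
    moreover have "of_real (1 + snd (g z)) \<noteq> (0::complex)" using g[OF zc] by (simp only: of_real_eq_0_iff)
    hence "fst (g z) = 0" using h0[OF z] unfolding h_def by (metis complex_cnj_zero_iff divide_eq_0_iff)
    ultimately show ?thesis using g[OF zc] by (cases "g z") (auto simp: norm_Pair power2_eq_1_iff)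
  qed
  thus ?thesis using e(1) by blast
qed

text \<open>The set where the limit is infinite is open by the preceding lemma, closed by continuity
  of the limit, and contains \<open>z0\<close>; connectedness does the rest.\<close>

lemma spherical_limit_infinity:
  assumes V: "open V" "connected V" and hol: "\<And>n. s n holomorphic_on V"
    and lim: "\<And>K. compact K \<Longrightarrow> K \<subseteq> V \<Longrightarrow> uniform_limit K (\<lambda>n z. to_sphere (s n z)) g sequentially"
    and z0: "z0 \<in> V" "filterlim (\<lambda>n. s n z0) at_infinity sequentially"
    and z: "z \<in> V"
  shows "filterlim (\<lambda>n. s n z) at_infinity sequentially"
proof -
  have pw: "(\<lambda>n. to_sphere (s n w)) \<longlonglongrightarrow> g w" if "w \<in> V" for w
    by (rule tendsto_uniform_limitI[OF lim[of "{w}"]]) (use that in auto)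
  have cont: "continuous_on V g"
    unfolding continuous_on_eq_continuous_at[OF V(1)]
  proof
    fix w assume "w \<in> V"
    then obtain r where r: "r > 0" "cball w r \<subseteq> V" using V open_contains_cball by blast
    have "continuous_on (cball w r) g"
    proof (rule uniform_limit_theorem[OF _ lim[OF compact_cball r(2)]])
      show "\<forall>\<^sub>F n in sequentially. continuous_on (cball w r) (\<lambda>z. to_sphere (s n z))"
        using hol r(2) by (intro always_eventually allI continuous_on_compose2[OF continuous_to_sphere[of UNIV]])
          (auto intro: holomorphic_on_imp_continuous_on holomorphic_on_subset)
    qed simp
    thus "isCont g w" using r(1) by (intro continuous_on_interior) auto
  qed
  define A where "A = {w \<in> V. g w = (0, 1)}"
  have "openin (top_of_set V) A"
    unfolding openin_open_eq[OF V(1)] A_def open_contains_ball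
  proof (intro conjI ballI)
    fix w assume "w \<in> {w \<in> V. g w = (0, 1)}"
    then obtain e where "e > 0" "\<forall>z\<in>ball w e. g z = (0, 1)"
      using spherical_limit_infinity_near[OF V(1) hol lim] by blast
    moreover obtain d where "d > 0" "ball w d \<subseteq> V" using V(1) \<open>w \<in> _\<close> open_contains_ball by blast
    ultimately show "\<exists>e>0. ball w e \<subseteq> {w \<in> V. g w = (0, 1)}" by (intro exI[of _ "min d e"]) auto
  qed auto
  moreover have "closedin (top_of_set V) A"
    unfolding A_def by (rule continuous_closedin_preimage_constant[OF cont])
  moreover have "z0 \<in> A"
    using z0 pw[OF z0(1)] LIMSEQ_unique unfolding A_def to_sphere_tendsto_infinity_iff[symmetric] by blast
  ultimately have "A = V" using V(2) unfolding connected_clopen by blast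
  hence "g z = (0, 1)" using z unfolding A_def by blast
  thus ?thesis using pw[OF z] by (simp add: to_sphere_tendsto_infinity_iff)
qed

lemma normal_family_on_subsequence:
  assumes "normal_family_on \<F> V" "range s \<subseteq> \<F>"
  obtains r :: "nat \<Rightarrow> nat" and g where "strict_mono r"
    "\<And>K. compact K \<Longrightarrow> K \<subseteq> V \<Longrightarrow> uniform_limit K (\<lambda>n z. to_sphere (s (r n) z)) g sequentially"
proof -
  obtain r g where rg: "strict_mono (r :: nat \<Rightarrow> nat) \<and> (\<forall>K. compact K \<and> K \<subseteq> V \<longrightarrow>
      uniform_limit K (\<lambda>n z. to_sphere (s (r n) z)) g sequentially)"
    using assms(1)[unfolded normal_family_on_def, THEN spec, THEN mp, OF assms(2)] by (elim exE)
  show ?thesis by (rule that[of r g]) (use rg in simp_all)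
qed

section \<open>Invariance of the Fatou set and spreading of escape\<close>

lemma open_fatou_set: "open (fatou_set f)"
  unfolding fatou_set_def
  by (subst open_subopen) blast

lemma fatou_set_no_pole: "z \<in> fatou_set f \<Longrightarrow> \<not> is_pole f z"
  by (auto simp: fatou_set_def iterates_defined_def dest!: bspec spec[of _ "0::nat"])

context
  fixes f :: "complex \<Rightarrow> complex"
  assumes open_nonpoles: "open {z. \<not> is_pole f z}"
    and hol: "f holomorphic_on {z. \<not> is_pole f z}"
    and nonconst: "\<And>z r. r > 0 \<Longrightarrow> ball z r \<subseteq> {z. \<not> is_pole f z} \<Longrightarrow> \<not> f constant_on ball z r"
begin

lemma iterates_holomorphic:
  assumes "\<And>z. z \<in> V \<Longrightarrow> iterates_defined f z"
  shows "(f ^^ n) holomorphic_on V"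
proof (induction n)
  case 0
  show ?case by (simp add: id_def)
next
  case (Suc n)
  show ?case unfolding funpow.simps
    by (rule holomorphic_on_compose_gen[OF Suc hol]) (use assms in \<open>auto simp: iterates_defined_def\<close>)
qed

text \<open>By the open mapping theorem the image of a small ball is a neighbourhood of
  \<open>f z\<close>. Normality of the iterates there is normality of the iterates
  \<open>f ^^ Suc n\<close> on the ball.\<close>

lemma fatou_set_image: "f ` fatou_set f \<subseteq> fatou_set f"
proof safe
  fix z assume "z \<in> fatou_set f"
  then obtain V where V: "open V" "z \<in> V" "\<And>w. w \<in> V \<Longrightarrow> iterates_defined f w"
    and normal: "normal_family_on (range (\<lambda>n. f ^^ n)) V" unfolding fatou_set_def by blast
  obtain r where r: "r > 0" "cball z r \<subseteq> V" using V open_contains_cball by blast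
  have "\<not> is_pole f w" if "w \<in> V" for w
    using V(3)[OF that, unfolded iterates_defined_def, rule_format, of 0] by simp
  hence np: "ball z r \<subseteq> {z. \<not> is_pole f z}" using r(2) ball_subset_cball by blast
  have "open (f ` ball z r)"
    by (rule open_mapping_thm[of f "ball z r"]) (use hol np nonconst[OF r(1) np] in \<open>auto intro: holomorphic_on_subset\<close>)
  moreover have "f z \<in> f ` ball z r" using r(1) by auto
  moreover have "iterates_defined f w" if w: "w \<in> f ` ball z r" for w
    unfolding iterates_defined_def
  proof
    fix n
    obtain u where "w = f u" "u \<in> V" using w r(2) ball_subset_cball by blast
    thus "\<not> is_pole f ((f ^^ n) w)"
      using V(3)[of u] unfolding iterates_defined_def by (metis funpow_swap1 comp_apply funpow_Suc_right)
  qed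
  moreover have "normal_family_on (range (\<lambda>n. f ^^ n)) (f ` ball z r)"
    unfolding normal_family_on_def
  proof (intro allI impI)
    fix \<sigma> :: "nat \<Rightarrow> complex \<Rightarrow> complex" assume "range \<sigma> \<subseteq> range (\<lambda>n. f ^^ n)"
    hence "\<forall>i. \<exists>k. \<sigma> i = f ^^ k" by blast
    then obtain k where k: "\<And>i. \<sigma> i = f ^^ k i" by metis
    have "range (\<lambda>i. f ^^ Suc (k i)) \<subseteq> range (\<lambda>n. f ^^ n)" by blast
    from normal_family_on_subsequence[OF normal this]
    obtain \<rho> :: "nat \<Rightarrow> nat" and g where \<rho>: "strict_mono \<rho>"
      and lim: "\<And>K. compact K \<Longrightarrow> K \<subseteq> V \<Longrightarrow> uniform_limit K (\<lambda>n z. to_sphere ((f ^^ Suc (k (\<rho> n))) z)) g sequentially"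
      by blast
    \<comment> \<open>Any choice of preimages serves: convergence is uniform on the whole compact
      ball, so it transfers to the image pointwise along \<open>u\<close>.\<close>
    define u where "u w = (SOME u. u \<in> ball z r \<and> f u = w)" for w
    have u: "u w \<in> ball z r" "f (u w) = w" if "w \<in> f ` ball z r" for w
      using someI_ex[of "\<lambda>u. u \<in> ball z r \<and> f u = w"] that unfolding u_def by blast+
    have "uniform_limit K (\<lambda>n w. to_sphere (\<sigma> (\<rho> n) w)) (\<lambda>w. g (u w)) sequentially"
      if K: "K \<subseteq> f ` ball z r" for K
    proof (rule uniform_limitI)
      fix e :: real assume "e > 0"
      with lim[OF compact_cball r(2)]
      have "\<forall>\<^sub>F n in sequentially. \<forall>x\<in>cball z r. dist (to_sphere ((f ^^ Suc (k (\<rho> n))) x)) (g x) < e"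
        by (rule uniform_limitD)
      thus "\<forall>\<^sub>F n in sequentially. \<forall>w\<in>K. dist (to_sphere (\<sigma> (\<rho> n) w)) (g (u w)) < e"
      proof eventually_elim
        case (elim n)
        show ?case
        proof
          fix w assume "w \<in> K"
          hence "w \<in> f ` ball z r" using K by blast
          note w = u[OF this]
          have "(f ^^ Suc (k (\<rho> n))) (u w) = \<sigma> (\<rho> n) w"
            unfolding funpow_Suc_right k by (simp add: w(2))
          thus "dist (to_sphere (\<sigma> (\<rho> n) w)) (g (u w)) < e"
            using bspec[OF elim, of "u w"] w(1) by simp
        qed
      qed
    qed
    thus "\<exists>r' g'. strict_mono r' \<and> (\<forall>K. compact K \<and> K \<subseteq> f ` ball z r \<longrightarrow>
        uniform_limit K (\<lambda>n w. to_sphere (\<sigma> (r' n) w)) g' sequentially)"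
      using \<rho> by blast
  qed
  ultimately show "f z \<in> fatou_set f" unfolding fatou_set_def by blast
qed

text \<open>A sequence of iterates either repeats one index infinitely often, which gives a constant
  subsequence, or its indices tend to infinity, and then it converges uniformly to infinity.\<close>

lemma escaping_subset_fatou_set:
  assumes W: "open W" "\<And>z. z \<in> W \<Longrightarrow> \<not> is_pole f z" "f ` W \<subseteq> W"
    and escape: "\<And>R. \<exists>N. \<forall>n\<ge>N. \<forall>z\<in>W. norm ((f ^^ n) z) \<ge> R"
  shows "W \<subseteq> fatou_set f"
proof -
  have "(f ^^ n) z \<in> W" if "z \<in> W" for n z using that W(3) by (induction n) auto
  hence it: "\<forall>z\<in>W. iterates_defined f z" using W(2) by (auto simp: iterates_defined_def)
  have "normal_family_on (range (\<lambda>n. f ^^ n)) W"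
    unfolding normal_family_on_def
  proof (intro allI impI)
    fix \<sigma> :: "nat \<Rightarrow> complex \<Rightarrow> complex" assume "range \<sigma> \<subseteq> range (\<lambda>n. f ^^ n)"
    hence "\<forall>i. \<exists>k. \<sigma> i = f ^^ k" by blast
    then obtain k where k: "\<And>i. \<sigma> i = f ^^ k i" by metis
    show "\<exists>r g. strict_mono r \<and> (\<forall>K. compact K \<and> K \<subseteq> W \<longrightarrow>
        uniform_limit K (\<lambda>n w. to_sphere (\<sigma> (r n) w)) g sequentially)"
    proof (cases "\<exists>m. infinite {i. k i = m}")
      case True
      then obtain m where "infinite {i. k i = m}" by blast
      from infinite_enumerate[OF this]
      obtain r where r: "strict_mono (r :: nat \<Rightarrow> nat)" "\<And>n. k (r n) = m" by blast
      have "uniform_limit K (\<lambda>n w. to_sphere (\<sigma> (r n) w)) (\<lambda>w. to_sphere ((f ^^ m) w)) sequentially" for K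
        unfolding k r(2) by (rule uniform_limit_const)
      thus ?thesis using r(1) by blast
    next
      case False
      have "uniform_limit K (\<lambda>n w. to_sphere (\<sigma> (id n) w)) (\<lambda>w. (0, 1)) sequentially" if K: "K \<subseteq> W" for K
      proof (rule uniform_limitI)
        fix e :: real assume e: "e > 0"
        \<comment> \<open>With 5 in place of the 4 from \<open>dist_to_sphere_infinity_le\<close>
          the final inequality becomes strict.\<close>
        obtain N where N: "\<And>n z. n \<ge> N \<Longrightarrow> z \<in> W \<Longrightarrow> norm ((f ^^ n) z) \<ge> max 1 (5 / e)"
          using escape by metis
        have "{i. k i < N} = (\<Union>m<N. {i. k i = m})" by auto
        moreover have "finite (\<Union>m<N. {i. k i = m})" using False by blast
        ultimately have "finite {i. k i < N}" by simp
        then obtain M where M: "\<forall>i\<in>{i. k i < N}. i < M" using finite_nat_set_iff_bounded by blast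
        have "k n \<ge> N" if "n \<ge> M" for n
        proof (rule ccontr)
          assume "\<not> k n \<ge> N"
          hence "n < M" using M by auto
          thus False using that by simp
        qed
        hence "\<forall>\<^sub>F n in sequentially. k n \<ge> N" using eventually_sequentially by blast
        thus "\<forall>\<^sub>F n in sequentially. \<forall>w\<in>K. dist (to_sphere (\<sigma> (id n) w)) (0, 1) < e"
        proof eventually_elim
          case (elim n)
          show ?case
          proof
            fix w assume "w \<in> K"
            hence w: "norm (\<sigma> n w) \<ge> 1" "norm (\<sigma> n w) \<ge> 5 / e" using N[OF elim, of w] K by (auto simp: k)
            have "dist (to_sphere (\<sigma> n w)) (0, 1) \<le> 4 / norm (\<sigma> n w)" by (rule dist_to_sphere_infinity_le[OF w(1)])
            also have "\<dots> \<le> 4 / (5 / e)" using w e by (intro divide_left_mono mult_pos_pos) auto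
            also have "\<dots> < e" using e by simp
            finally show "dist (to_sphere (\<sigma> (id n) w)) (0, 1) < e" by simp
          qed
        qed
      qed
      thus ?thesis by (intro exI[of _ id] exI[of _ "\<lambda>w. (0, 1)"]) (auto simp: strict_mono_def)
    qed
  qed
  thus ?thesis using W(1) it unfolding fatou_set_def by blast
qed

text \<open>In a ball where the iterates are normal, one escaping point forces all to escape: if
  \<open>w\<close> did not, some subsequence would stay bounded at \<open>w\<close>, yet a
  spherically convergent part of it is infinite at the escaping point and hence at \<open>w\<close>.
  So the interior of the escaping set is relatively closed in the component.\<close>

lemma escape_on_component:
  assumes U: "U \<in> components (fatou_set f)"
    and W: "open W" "W \<noteq> {}" "W \<subseteq> U" "\<And>z. z \<in> W \<Longrightarrow> filterlim (\<lambda>n. (f ^^ n) z) at_infinity sequentially"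
    and z: "z \<in> U"
  shows "filterlim (\<lambda>n. (f ^^ n) z) at_infinity sequentially"
proof -
  let ?esc = "\<lambda>z. filterlim (\<lambda>n. (f ^^ n) z) at_infinity sequentially"
  define A where "A = {z \<in> U. \<exists>N. open N \<and> z \<in> N \<and> (\<forall>w\<in>N. ?esc w)}"
  have "open U" "connected U" "U \<subseteq> fatou_set f"
    using open_components[OF open_fatou_set U] in_components_connected[OF U] in_components_subset[OF U] by auto
  have "A = U \<inter> \<Union>{N. open N \<and> (\<forall>w\<in>N. ?esc w)}" unfolding A_def by blast
  hence "open A" using \<open>open U\<close> by auto
  moreover have "open (U - A)"
    unfolding open_contains_ball
  proof
    fix z assume z: "z \<in> U - A"
    hence "z \<in> fatou_set f" using \<open>U \<subseteq> fatou_set f\<close> by blast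
    then obtain V where V: "open V" "z \<in> V" "\<And>w. w \<in> V \<Longrightarrow> iterates_defined f w"
      and normal: "normal_family_on (range (\<lambda>n. f ^^ n)) V"
      unfolding fatou_set_def by blast
    obtain r where r: "r > 0" "ball z r \<subseteq> V \<inter> U"
      using V(1,2) \<open>open U\<close> z open_contains_ball[of "V \<inter> U"] by blast
    have "ball z r \<inter> A = {}"
    proof (rule ccontr)
      assume "ball z r \<inter> A \<noteq> {}"
      then obtain z0 where z0: "z0 \<in> ball z r" "?esc z0" unfolding A_def by blast
      have "?esc w" if w: "w \<in> ball z r" for w
      proof (rule ccontr)
        assume "\<not> ?esc w"
        then obtain R where "R > 0" "\<not> (\<forall>\<^sub>F n in sequentially. norm ((f ^^ n) w) \<ge> R)"
          unfolding filterlim_at_infinity[OF order.refl] by auto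
        hence "infinite {n. norm ((f ^^ n) w) < R}"
          by (simp add: not_eventually not_le flip: frequently_cofinite cofinite_eq_sequentially)
        from infinite_enumerate[OF this]
        obtain k :: "nat \<Rightarrow> nat" where k: "strict_mono k" "\<And>n. norm ((f ^^ k n) w) < R" by blast
        have "range (\<lambda>i. f ^^ k i) \<subseteq> range (\<lambda>n. f ^^ n)" by blast
        from normal_family_on_subsequence[OF normal this]
        obtain \<rho> :: "nat \<Rightarrow> nat" and g where \<rho>: "strict_mono \<rho>"
          and lim: "\<And>K. compact K \<Longrightarrow> K \<subseteq> V \<Longrightarrow> uniform_limit K (\<lambda>n z. to_sphere ((f ^^ k (\<rho> n)) z)) g sequentially"
          by blast
        have "filterlim (\<lambda>n. k (\<rho> n)) sequentially sequentially"
          using filterlim_subseq strict_mono_o[OF k(1) \<rho>] by (simp add: o_def)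
        from filterlim_compose[OF z0(2) this]
        have "filterlim (\<lambda>n. (f ^^ k (\<rho> n)) w) at_infinity sequentially"
        proof (rule spherical_limit_infinity[OF open_ball _ iterates_holomorphic lim z0(1) _ w, rotated -1])
          show "\<And>z'. z' \<in> ball z r \<Longrightarrow> iterates_defined f z'" using V(3) r(2) by blast
          show "\<And>K. compact K \<Longrightarrow> K \<subseteq> ball z r \<Longrightarrow> K \<subseteq> V" using r(2) by blast
        qed auto
        hence "\<forall>\<^sub>F n in sequentially. norm ((f ^^ k (\<rho> n)) w) \<ge> R"
          unfolding filterlim_at_infinity[OF order.refl] using \<open>R > 0\<close> by blast
        then obtain n where "norm ((f ^^ k (\<rho> n)) w) \<ge> R" using eventually_happens by force
        thus False using k(2)[of "\<rho> n"] by simp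
      qed
      hence "z \<in> A" using z r(1) unfolding A_def by (auto intro!: exI[of _ "ball z r"])
      thus False using z by blast
    qed
    thus "\<exists>e>0. ball z e \<subseteq> U - A" using r by blast
  qed
  moreover have "A \<inter> U \<noteq> {}" using W unfolding A_def by blast
  moreover have "A \<inter> (U - A) \<inter> U = {}" "U \<subseteq> A \<union> (U - A)" by blast+
  ultimately have "(U - A) \<inter> U = {}"
    using connectedD[OF \<open>connected U\<close>, of A "U - A"] by blast
  thus ?thesis using z unfolding A_def by blast
qed

lemma invariant_baker_domainI:
  assumes W: "open W" "connected W" "W \<noteq> {}" "\<And>z. z \<in> W \<Longrightarrow> \<not> is_pole f z" "f ` W \<subseteq> W"
    and escape: "\<And>R. \<exists>N. \<forall>n\<ge>N. \<forall>z\<in>W. norm ((f ^^ n) z) \<ge> R"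
  shows "\<exists>U. invariant_baker_domain f U"
proof -
  have WF: "W \<subseteq> fatou_set f" by (rule escaping_subset_fatou_set[OF W(1,4,5) escape])
  obtain U where U: "U \<in> components (fatou_set f)" "W \<subseteq> U"
    using exists_component_superset[OF WF _ W(2)] WF W(3) by blast
  have Usub: "U \<subseteq> fatou_set f" using U(1) in_components_subset by blast
  have "f ` U \<subseteq> U"
  proof (rule components_maximal[OF U(1)])
    have "continuous_on U f"
      using hol Usub fatou_set_no_pole by (blast intro: holomorphic_on_imp_continuous_on holomorphic_on_subset)
    thus "connected (f ` U)" using in_components_connected[OF U(1)] connected_continuous_image by blast
    show "f ` U \<subseteq> fatou_set f" using fatou_set_image Usub by blast
    show "U \<inter> f ` U \<noteq> {}" using W(3,5) U(2) by blast
  qed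
  moreover have "filterlim (\<lambda>n. (f ^^ n) z) at_infinity sequentially" if "z \<in> U" for z
  proof (rule escape_on_component[OF U(1) W(1,3) U(2) _ that])
    fix w assume "w \<in> W"
    thus "filterlim (\<lambda>n. (f ^^ n) w) at_infinity sequentially"
      unfolding filterlim_at_infinity[OF order.refl] eventually_sequentially using escape by blast
  qed
  ultimately show ?thesis
    using U(1) unfolding invariant_baker_domain_def invariant_fatou_component_def by blast
qed

end

subsection \<open>Singular values and the Baker domain\<close>

context configuration
begin

lemma c_near_pole: "norm (c j - p (j div 2) - sg j) \<le> 5/1000"
proof -
  have "c j - p (j div 2) - sg j = (c j - (base (j div 2) + sg j)) - (p (j div 2) - base (j div 2))" by simp
  also have "norm \<dots> \<le> norm (c j - (base (j div 2) + sg j)) + norm (p (j div 2) - base (j div 2))"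
    by (rule norm_triangle_ineq4)
  finally show ?thesis using c_near[of j] p_near[of "j div 2"] by linarith
qed

lemma c_neq: "c j \<noteq> p (j div 2)"
proof
  assume "c j = p (j div 2)"
  thus False using c_near_pole[of j] by simp
qed

lemma c_apart: "apart p (j div 2) (c j)"
proof (rule apartI[OF near])
  have "norm (c j - base (j div 2)) \<le> norm (c j - (base (j div 2) + sg j)) + norm (sg j)" by norm
  thus "norm (c j - base (j div 2)) \<le> 2" using c_near[of j] by simp
qed

lemma v_apart: "apart p (Suc j) (v j)"
  using v_near[of j] by (intro apartI[OF near]) auto

lemma c_not_pole: "c j \<notin> range p" and v_not_pole: "v j \<notin> range p"
  by (rule not_pole_point[OF c_apart c_neq], rule not_pole_point[OF v_apart v_neq])

lemma f_c: "f (c j) = v j" and f_v: "f (v j) = c j"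
  by (rule trans[OF f_eq[OF c_not_pole] crit_value[symmetric]],
      rule trans[OF f_eq[OF v_not_pole] value_returns[symmetric]])

lemma f_deriv_c: "(f has_field_derivative 0) (at (c j))"
proof -
  define n where "n = j div 2"
  have "c j - p n \<noteq> 0" using c_neq by (simp add: n_def)
  moreover have "(c j - p n)\<^sup>2 * (1 - tail 2 p s n (c j)) = (s n)\<^sup>2" using critical[of j] by (simp add: n_def)
  ultimately have "1 - tail 2 p s n (c j) = (s n)\<^sup>2 / (c j - p n)\<^sup>2" by (simp add: field_simps)
  hence "1000000 * (1 - (s n)\<^sup>2 / (c j - p n)\<^sup>2 - tail 2 p s n (c j)) = 0" by (simp add: algebra_simps)
  with f_has_derivative[OF c_apart c_neq, of j] show ?thesis by (simp add: n_def)
qed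

text \<open>\<open>v j\<close> lies next to pole \<open>Suc j\<close> and \<open>c j\<close> next to
  its parent \<open>j div 2\<close>; these are always distinct poles, hence far apart.\<close>

lemma v_neq_c: "v j \<noteq> c j"
proof
  assume eq: "v j = c j"
  have "norm (b - b') \<le> norm (x - b) + norm (x - (b' + y)) + norm y" for x y b b' :: complex by norm
  from this[of "base (Suc j)" "base (j div 2)" "c j" "sg j"]
  have "norm (base (Suc j) - base (j div 2)) \<le>
      norm (v j - base (Suc j)) + norm (c j - (base (j div 2) + sg j)) + norm (sg j)" by (simp only: eq)
  moreover have "norm (base (Suc j) - base (j div 2)) \<ge> 2000000"
  proof -
    have "j div 2 \<noteq> Suc j" using div_le_dividend[of j 2] by linarith
    from square_distance_ge_1[OF this] base_separated[of "j div 2" "Suc j"] show ?thesis by linarith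
  qed
  ultimately show False using v_near[of j] c_near[of j] by simp
qed

lemma v_super_attracting: "super_attracting_period_2 f (v j)"
proof -
  have "\<exists>D. (f has_field_derivative D) (at (v j))"
    using f_has_derivative[OF v_apart v_neq] by blast
  then obtain D where D: "(f has_field_derivative D) (at (v j))" ..
  have "(f has_field_derivative 0) (at (f (v j)))" using f_deriv_c[of j] by (simp add: f_v)
  from DERIV_chain[OF this D] have "((f ^^ 2) has_field_derivative 0) (at (v j))"
    by (simp add: numeral_2_eq_2)
  thus ?thesis
    unfolding super_attracting_period_2_def using v_neq_c[of j] v_not_pole[of j] c_not_pole[of j]
    by (simp add: f_v f_c is_pole_f_iff eq_commute)
qed

text \<open>Writing \<open>Z = z - p n\<close>, the critical equation reads \<open>Z\<^sup>2 (1 - e(z)) = s n\<^sup>2\<close> with a small and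
  slowly varying \<open>e\<close>, so in each half plane \<open>\<plusminus>Re Z \<ge> 0\<close> it has only one solution.\<close>

lemma critical_point_eq_c:
  assumes z: "z \<notin> range p" and D: "(f has_field_derivative 0) (at z)"
  shows "z \<in> range c"
proof -
  obtain n where n: "apart p n z" using apart_exists by blast
  define Z where "Z = z - p n"
  define e where "e = tail 2 p s n"
  have Z0: "Z \<noteq> 0" using z by (auto simp: Z_def)
  have "z \<noteq> p n" using z by auto
  from DERIV_unique[OF f_has_derivative[OF n this] D]
  have "1 - (s n)\<^sup>2 / Z\<^sup>2 - e z = 0"
    unfolding Z_def e_def by (metis mult_eq_0_iff zero_neq_numeral)
  hence Zeq: "Z\<^sup>2 * (1 - e z) = (s n)\<^sup>2" using Z0 by (simp add: field_simps)
  \<comment> \<open>The critical point in the same half plane as \<open>Z\<close> is chosen, so that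
    \<open>Z + C\<close> stays away from 0.\<close>
  define j where "j = (if Re Z \<ge> 0 then 2 * n + 1 else 2 * n)"
  have jn: "j div 2 = n" by (simp add: j_def)
  define C where "C = c j - p n"
  have Ceq: "C\<^sup>2 * (1 - e (c j)) = (s n)\<^sup>2" using critical[of j] by (simp add: jn C_def e_def)
  have Cnear: "norm (C - sg j) \<le> 5/1000" using c_near_pole[of j] by (simp add: jn C_def)
  have ez: "norm (e z) \<le> 1/40000" and ec: "norm (e (c j)) \<le> 1/40000"
    unfolding e_def using tail_le[OF near n, of 2] tail_le[OF near c_apart[of j, unfolded jn], of 2] by simp_all
  \<comment> \<open>The perturbation lemma with the same poles and roots on both sides and only the
    point moved, so that \<open>K\<close> is \<open>norm (Z - C)\<close>.\<close>
  have ediff: "norm (e z - e (c j)) \<le> norm (Z - C) / 1000"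
    unfolding e_def
    by (rule tail_diff_le[OF near near n c_apart[of j, unfolded jn]]) (auto simp: Z_def C_def)
  have "norm C \<le> norm (C - sg j) + norm (sg j)" by norm
  hence Cn: "norm C \<le> 1005/1000" using Cnear by simp
  hence C2: "norm (C\<^sup>2) \<le> 2" using power_mono[OF Cn, of 2] by (simp add: norm_mult power2_eq_square)
  have sum: "norm (Z + C) \<ge> 99/100"
  proof -
    have "Re (sg j * Z) \<ge> 0" by (auto simp: j_def sg_def)
    moreover have "Re (sg j * C) \<ge> 99/100"
    proof -
      have "sg j * C = 1 + sg j * (C - sg j)" by (simp add: algebra_simps)
      moreover have "\<bar>Re (sg j * (C - sg j))\<bar> \<le> norm (sg j * (C - sg j))" by (rule abs_Re_le_cmod)
      ultimately show ?thesis using Cnear by (simp add: norm_mult)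
    qed
    moreover have "Re (sg j * (Z + C)) \<le> norm (sg j * (Z + C))" by (rule complex_Re_le_cmod)
    ultimately have "norm (sg j * (Z + C)) \<ge> 99/100" by (simp only: distrib_left plus_complex.sel)
    thus ?thesis by (simp add: norm_mult)
  qed
  \<comment> \<open>The difference of the two critical equations. Its right side is a small multiple
    of \<open>Z - C\<close>, while \<open>Z + C\<close> is bounded below, so
    \<open>Z = C\<close>.\<close>
  have "(Z - C) * (Z + C) = e z * (Z\<^sup>2 - C\<^sup>2) + (e z - e (c j)) * C\<^sup>2"
    using Zeq Ceq by algebra
  hence "norm (Z - C) * norm (Z + C) = norm (e z * (Z\<^sup>2 - C\<^sup>2) + (e z - e (c j)) * C\<^sup>2)"
    by (simp only: flip: norm_mult)
  also have "\<dots> \<le> norm (e z) * norm (Z\<^sup>2 - C\<^sup>2) + norm (e z - e (c j)) * norm (C\<^sup>2)"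
    by (rule order_trans[OF norm_triangle_ineq]) (simp add: norm_mult)
  also have "\<dots> \<le> (1/40000) * norm (Z\<^sup>2 - C\<^sup>2) + (norm (Z - C) / 1000) * 2"
    using ez ediff C2 by (intro add_mono mult_mono) auto
  also have "Z\<^sup>2 - C\<^sup>2 = (Z - C) * (Z + C)" by (simp add: power2_eq_square algebra_simps)
  finally have "norm (Z - C) * norm (Z + C)
      \<le> 1/40000 * (norm (Z - C) * norm (Z + C)) + norm (Z - C) / 1000 * 2"
    by (simp only: norm_mult)
  hence "norm (Z - C) * (39999/40000 * norm (Z + C) - 2/1000) \<le> 0"
    by (simp add: algebra_simps)
  moreover have "39999/40000 * norm (Z + C) - 2/1000 > 0" using sum by simp
  ultimately have "norm (Z - C) \<le> 0" by (simp add: mult_le_0_iff)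
  hence "z = c j" by (simp add: Z_def C_def)
  thus ?thesis by blast
qed

section \<open>Critical and asymptotic values\<close>

lemma finite_critical_values_f: "finite_critical_values f \<subseteq> range v"
proof
  fix a assume "a \<in> finite_critical_values f"
  then obtain z where z: "a = f z" "z \<notin> range p" "\<not> (\<exists>V. open V \<and> z \<in> V \<and> inj_on f V)"
    unfolding finite_critical_values_def is_pole_f_iff by blast
  have op: "open (- range p)" using closed_poles by auto
  have "deriv f z = 0"
  proof (rule ccontr)
    assume nz: "deriv f z \<noteq> 0"
    have "z \<in> - range p" using z(2) by simp
    from has_complex_derivative_locally_injective[OF f_holomorphic this op nz]
    obtain r where r: "r > 0" "inj_on f (ball z r)" by blast
    have "open (ball z r) \<and> z \<in> ball z r \<and> inj_on f (ball z r)" using r by simp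
    thus False using z(3) by blast
  qed
  moreover have "(f has_field_derivative deriv f z) (at z)"
    by (rule holomorphic_derivI[OF f_holomorphic op]) (use z(2) in auto)
  ultimately obtain j where "z = c j" using critical_point_eq_c[OF z(2)] by auto
  thus "a \<in> range v" using z(1) f_c by blast
qed

lemma f_bounded_below:
  assumes "\<And>n. norm (z - p n) \<ge> 1"
  shows "norm (f z) \<ge> 1000000 * (norm z - 3)"
proof -
  obtain n where n: "apart p n z" using apart_exists by blast
  define x y where "x = (s n)\<^sup>2 / (z - p n)" and "y = tail 1 p s n z"
  have "norm x \<le> 2 / 1"
    unfolding x_def norm_divide using near_norm_s2[OF near] assms by (intro frac_le) auto
  moreover have "norm y \<le> 1/40000" unfolding y_def by (rule tail_le[OF near n]) simp
  moreover have "norm z \<le> norm (z + x + y) + norm x + norm y" by norm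
  moreover have "z \<notin> range p"
  proof
    assume "z \<in> range p"
    then obtain n where "z = p n" by blast
    thus False using assms[of n] by simp
  qed
  hence "f z = 1000000 * (z + x + y)" unfolding x_def y_def by (rule f_eq)
  hence "norm (f z) = 1000000 * norm (z + x + y)" by (simp only: norm_mult) simp
  ultimately show ?thesis by simp
qed

text \<open>Where \<open>f\<close> is bounded, a point far out must lie in a unit disc about a pole.
  These discs are disjoint, so a connected end of the curve is trapped in a single one and cannot
  tend to infinity.\<close>

lemma finite_asymptotic_values_f: "finite_asymptotic_values f = {}"
proof (rule ccontr)
  assume "finite_asymptotic_values f \<noteq> {}"
  then obtain a where "a \<in> finite_asymptotic_values f" by blast
  then obtain \<gamma> :: "real \<Rightarrow> complex" where \<gamma>: "continuous_on {0..} \<gamma>" "filterlim \<gamma> at_infinity at_top" "((\<lambda>t. f (\<gamma> t)) \<longlongrightarrow> a) at_top"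
    unfolding finite_asymptotic_values_def by blast
  have large: "\<forall>\<^sub>F t in at_top. norm (\<gamma> t) > R" for R
    using filterlim_at_infinity_imp_norm_at_top[OF \<gamma>(2)] by (simp add: filterlim_at_top_dense)
  have "\<forall>\<^sub>F t in at_top. norm (f (\<gamma> t)) < norm a + 1"
    by (rule order_tendstoD(2)[OF tendsto_norm[OF \<gamma>(3)]]) simp
  \<comment> \<open>Outside the discs the lower bound is 10^6 times
    \<open>norm (\<gamma> t) - 3\<close>, which now exceeds \<open>norm a + 1\<close>.\<close>
  with large[of "norm a + 4"] have "\<forall>\<^sub>F t in at_top. \<exists>n. norm (\<gamma> t - p n) < 1"
  proof eventually_elim
    case (elim t)
    show ?case
    proof (rule ccontr)
      assume "\<not> ?thesis"
      hence "norm (f (\<gamma> t)) \<ge> 1000000 * (norm (\<gamma> t) - 3)" by (intro f_bounded_below) (simp add: not_less)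
      thus False using elim norm_ge_zero[of a] by (simp add: algebra_simps)
    qed
  qed
  then obtain T0 where T0: "\<And>t. t \<ge> T0 \<Longrightarrow> \<exists>n. norm (\<gamma> t - p n) < 1"
    unfolding eventually_at_top_linorder by blast
  define T where "T = max 0 T0"
  obtain n where n: "norm (\<gamma> T - p n) < 1" using T0[of T] by (auto simp: T_def)
  define A B where "A = ball (p n) 1" and "B = (\<Union>m\<in>-{n}. ball (p m) 1)"
  have "connected (\<gamma> ` {T..})"
    by (intro connected_continuous_image continuous_on_subset[OF \<gamma>(1)]) (auto simp: T_def)
  moreover have "open A" "open B" by (auto simp: A_def B_def)
  moreover have "A \<inter> B = {}"
  proof (rule ccontr)
    assume "A \<inter> B \<noteq> {}"
    then obtain m x where mx: "m \<noteq> n" "x \<in> ball (p n) 1" "x \<in> ball (p m) 1"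
      unfolding A_def B_def by blast
    hence "norm (x - p n) < 1" "norm (x - p m) < 1" by (simp_all add: dist_norm norm_minus_commute)
    moreover have "norm (p n - p m) \<le> norm (x - p n) + norm (x - p m)" by norm
    ultimately show False using p_separated_1[OF mx(1)] by linarith
  qed
  moreover have sub: "\<gamma> ` {T..} \<subseteq> A \<union> B"
  proof safe
    fix t assume t: "t \<ge> T" "\<gamma> t \<notin> B"
    then obtain m where "norm (\<gamma> t - p m) < 1" using T0[of t] by (auto simp: T_def)
    thus "\<gamma> t \<in> A" using t(2) by (cases "m = n") (auto simp: A_def B_def dist_norm norm_minus_commute)
  qed
  moreover have "\<gamma> T \<in> A \<inter> \<gamma> ` {T..}" using n by (auto simp: A_def dist_norm norm_minus_commute)
  ultimately have "B \<inter> \<gamma> ` {T..} = {}" using connectedD[of "\<gamma> ` {T..}" A B] by blast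
  hence in_A: "\<gamma> t \<in> A" if "t \<ge> T" for t using sub that by blast
  have "\<forall>\<^sub>F t in at_top. norm (\<gamma> t) > norm (p n) + 1 \<and> t \<ge> T"
    using large eventually_ge_at_top by (rule eventually_conj)
  then obtain t where t: "norm (\<gamma> t) > norm (p n) + 1" "t \<ge> T"
    by (auto simp: eventually_at_top_linorder)
  have "norm (\<gamma> t) \<le> norm (\<gamma> t - p n) + norm (p n)" by norm
  thus False using t in_A[OF t(2)] by (simp add: A_def dist_norm norm_minus_commute)
qed

section \<open>The invariant half plane\<close>

lemma f_left_half_plane:
  assumes z: "Re z < -1"
  shows "z \<notin> range p" "Re (f z) \<le> 2 * Re z"
proof -
  have far: "norm (z - p n) \<ge> 1000" for n
  proof -
    have "Re (p n) - Re z \<le> norm (z - p n)" using abs_Re_le_cmod[of "z - p n"] by simp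
    thus ?thesis using z Re_p_ge[of n] by linarith
  qed
  show np: "z \<notin> range p"
  proof
    assume "z \<in> range p"
    then obtain n where "z = p n" by blast
    thus False using far[of n] by simp
  qed
  obtain n where n: "apart p n z" using apart_exists by blast
  define w where "w = (s n)\<^sup>2 / (z - p n) + tail 1 p s n z"
  have "norm ((s n)\<^sup>2 / (z - p n)) \<le> 2 / 1000"
    unfolding norm_divide using near_norm_s2[OF near] far by (intro frac_le) auto
  moreover have "norm (tail 1 p s n z) \<le> 1/40000" by (rule tail_le[OF near n]) simp
  ultimately have "norm w \<le> 1/2" 
    unfolding w_def by (intro order_trans[OF norm_triangle_ineq]) simp
  hence "Re w \<le> 1/2" using complex_Re_le_cmod[of w] by linarith
  moreover have "f z = 1000000 * (z + w)" using f_eq[OF np, of n] by (simp only: w_def add.assoc)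
  hence "Re (f z) = 1000000 * (Re z + Re w)" by simp
  ultimately show "Re (f z) \<le> 2 * Re z" using z by (simp add: algebra_simps)
qed

text \<open>Otherwise every point of the ball would be critical, but the critical points are
  countable.\<close>

lemma f_not_constant_on_ball:
  assumes "r > 0" "ball z r \<subseteq> - range p"
  shows "\<not> f constant_on ball z r"
proof
  assume "f constant_on ball z r"
  then obtain a where a: "\<And>w. w \<in> ball z r \<Longrightarrow> f w = a" unfolding constant_on_def by blast
  have "ball z r \<subseteq> range c"
  proof
    fix w assume w: "w \<in> ball z r"
    have "((\<lambda>_. a) has_field_derivative 0) (at w)" by simp
    hence "(f has_field_derivative 0) (at w)"
      by (rule has_field_derivative_transform_within_open[OF _ open_ball w]) (use a in auto)
    thus "w \<in> range c" using critical_point_eq_c assms(2) w by blast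
  qed
  hence "countable (ball z r)" by (rule countable_subset) simp
  thus False using uncountable_ball[OF assms(1)] by blast
qed

lemma f_baker_domain: "\<exists>U. invariant_baker_domain f U"
proof -
  define W where "W = {z. Re z < -1}"
  show ?thesis
  proof (rule invariant_baker_domainI[where W = W])
    have np: "{z. \<not> is_pole f z} = - range p" by (auto simp: is_pole_f_iff)
    show "open {z. \<not> is_pole f z}" "f holomorphic_on {z. \<not> is_pole f z}"
      unfolding np using closed_poles f_holomorphic by auto
    show "\<not> f constant_on ball z r" if "r > 0" "ball z r \<subseteq> {z. \<not> is_pole f z}" for z r
      using f_not_constant_on_ball[of r z] that unfolding np by blast
    show "open W" unfolding W_def by (rule open_halfspace_Re_lt)
    show "connected W" unfolding W_def by (intro convex_connected convex_halfspace_Re_lt)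
    show "W \<noteq> {}" unfolding W_def by (rule ex_in_conv[THEN iffD1]) (rule exI[of _ "-2"], simp)
    show "\<not> is_pole f z" if "z \<in> W" for z using f_left_half_plane(1) that by (simp add: W_def is_pole_f_iff)
    show sub: "f ` W \<subseteq> W" using f_left_half_plane(2) by (force simp: W_def)
    have iter: "(f ^^ n) z \<in> W \<and> Re ((f ^^ n) z) \<le> - (2 ^ n)" if "z \<in> W" for n z
    proof (induction n)
      case (Suc n)
      hence "Re (f ((f ^^ n) z)) \<le> 2 * Re ((f ^^ n) z)" by (intro f_left_half_plane(2)) (simp add: W_def)
      thus ?case using Suc sub by auto
    qed (use that in \<open>simp add: W_def\<close>)
    fix R :: real
    obtain N :: nat where N: "R < 2 ^ N" using real_arch_pow[of 2 R] by auto
    have "norm ((f ^^ n) z) \<ge> R" if "n \<ge> N" "z \<in> W" for n z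
    proof -
      have "(2::real) ^ N \<le> 2 ^ n" using that(1) by (intro power_increasing) auto
      moreover have "\<bar>Re ((f ^^ n) z)\<bar> \<ge> 2 ^ n" using iter[OF that(2), of n] by linarith
      ultimately show ?thesis using N abs_Re_le_cmod[of "(f ^^ n) z"] by linarith
    qed
    thus "\<exists>N. \<forall>n\<ge>N. \<forall>z\<in>W. R \<le> norm ((f ^^ n) z)" by blast
  qed
qed

end

theorem theorem1p2:
  shows "\<exists>f :: complex \<Rightarrow> complex.
           transcendental_meromorphic f \<and>
           (\<exists>U. invariant_baker_domain f U) \<and>
           (\<forall>a \<in> sing_inverse f. super_attracting_period_2 f a)"
proof -
  obtain p s c v where "configuration p s c v" using configuration_exists by blast
  then interpret configuration p s c v .
  show ?thesis
    using f_transcendental f_baker_domain v_super_attracting finite_critical_values_f finite_asymptotic_values_f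
    unfolding sing_inverse_def by blast
qed

end
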